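(* There exists an absolute constant $C>0$ such that the following holds. For any subset $A$ of $[n]$ of size $m\ge C\sqrt n$, there exists an integer $d\ge1$ such that, for $A'=\{x/d: x\in A,\ d\mid x\}$ and $k=2^{50}n/m$, the set $\Sigma^{[k]}(A')$ contains an interval of integers of length at least $n$. Furthermore, \[|A|-|A'|\le 2^{30}(\log n)^3+\frac{2^{30}n}{m}.\]
   Context: $[n]=\{1,\dots,n\}$, $\log$ is the natural logarithm, and for a set $A$ of integers, $\Sigma^{[h]}(A)=\{\sum_{s\in S}s: S\subseteq A,\ |S|\le h\}$. *)

theory Defs
  imports Complex_Main
begin

definition subset_sums_le :: "real \<Rightarrow> int set \<Rightarrow> int set" where
  "subset_sums_le h A = {\<Sum>S | S. S \<subseteq> A \<and> finite S \<and> real (card S) \<le> h}"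

definition div_part :: "int \<Rightarrow> int set \<Rightarrow> int set" where
  "div_part d A = {x div d | x. x \<in> A \<and> d dvd x}"

end

theory Submission
  imports Defs
begin

text \<open>
  Let \<open>B\<close> be a set of \<open>M\<close> integers in a window of length \<open>l\<close>, where \<open>M\<^sup>2\<close> is large compared with
  \<open>l\<close>, and let \<open>D\<^sub>j\<close> be the set of integers with more than \<open>2j\<close> representations as a sum of two
  distinct elements of \<open>B\<close>. Sums of one element from each of \<open>D\<^sub>0, D\<^sub>1, \<dots>\<close> can be realised with
  pairwise distinct summands, and since all pairs are counted by the \<open>|D\<^sub>j|\<close> together, no dyadic
  pigeonholing (and no logarithm) is needed. If \<open>B\<close> is not concentrated on a much shorter window,
  some \<open>D\<^sub>t\<close> with \<open>t = O(l/M)\<close> has two elements at a distance \<open>g\<close> comparable to \<open>l\<close>: these supply the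
  multiples of \<open>g\<close>, while a weak form of Kneser's theorem modulo \<open>g\<close> lets \<open>D\<^sub>0, D\<^sub>1, \<dots>\<close> cover a
  residue class modulo some \<open>q = O(l/M)\<close>. This gives a long progression with difference \<open>q\<close>. If \<open>B\<close>
  is concentrated, induct on the shorter window. In both cases the other half of \<open>B\<close> is used in pairs,
  first to replace \<open>q\<close> by a divisor modulo which almost all of \<open>B\<close> is constant, then to lengthen the
  progression.

  For the theorem take the largest \<open>d \<le> 1024 n/m\<close> such that at most \<open>64 d\<close> elements of \<open>A\<close> are not divisible by \<open>d\<close>.
  By maximality, for each relevant \<open>e \<ge> 2\<close> many elements of \<open>A'\<close> are not divisible by \<open>e\<close>. A random half
  \<open>R\<close> of \<open>A'\<close> inherits this; the remaining half gives a long progression with some difference \<open>q\<close>, and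
  fewer than \<open>q\<close> elements of \<open>R\<close> have subset sums in all residue classes modulo \<open>q\<close>.
\<close>

section \<open>Periodic sets of integers and a weak form of Kneser's theorem\<close>

definition periodic :: "int \<Rightarrow> int set \<Rightarrow> bool" where
  "periodic p T \<longleftrightarrow> (\<forall>z. z + p \<in> T \<longleftrightarrow> z \<in> T)"

text \<open>For a \<open>g\<close>-periodic \<open>T\<close> this counts the residue classes modulo
  \<open>g\<close> in \<open>T\<close>. Subsets of cyclic groups are represented by their periodic
  preimages in the integers, so the modulus can change without changing the type.\<close>

definition dens :: "int \<Rightarrow> int set \<Rightarrow> nat" where
  "dens g T = card (T \<inter> {0..<g})"

definition sumset :: "int set \<Rightarrow> int set \<Rightarrow> int set" where
  "sumset A B = {a + b | a b. a \<in> A \<and> b \<in> B}"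

definition periodize :: "int \<Rightarrow> int set \<Rightarrow> int set" where
  "periodize g T = {z. \<exists>t\<in>T. g dvd z - t}"

definition translate :: "int \<Rightarrow> int set \<Rightarrow> int set" where
  "translate c T = {z. z - c \<in> T}"

lemma mem_translate: "z \<in> translate c T \<longleftrightarrow> z - c \<in> T"
  by (simp add: translate_def)

section \<open>Arithmetic of periods\<close>

lemma periodicD: "periodic p T \<Longrightarrow> z + p \<in> T \<longleftrightarrow> z \<in> T"
  by (simp add: periodic_def)

lemma periodic_uminus:
  assumes "periodic p T" shows "periodic (- p) T"
  unfolding periodic_def using periodicD[OF assms, of "_ - p"] by simp

lemma periodic_add:
  assumes "periodic p T" "periodic r T" shows "periodic (p + r) T"
  unfolding periodic_def using periodicD[OF assms(1)] periodicD[OF assms(2)]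
  by (metis add.assoc)

lemma periodic_mult_nat: "periodic p T \<Longrightarrow> periodic (int k * p) T"
proof (induction k)
  case 0 then show ?case by (simp add: periodic_def)
next
  case (Suc k)
  then show ?case using periodic_add[of "int k * p" T p] by (simp add: algebra_simps)
qed

lemma periodic_mult:
  assumes "periodic p T" shows "periodic (k * p) T"
proof (cases "k \<ge> 0")
  case True
  then show ?thesis using periodic_mult_nat[OF assms, of "nat k"] by simp
next
  case False
  then show ?thesis
    using periodic_uminus[OF periodic_mult_nat[OF assms, of "nat (- k)"]] by simp
qed

lemma periodic_dvd: "periodic p T \<Longrightarrow> p dvd r \<Longrightarrow> periodic r T"
  using periodic_mult by (metis dvdE mult.commute)

lemma periodic_gcd:
  assumes "periodic p T" "periodic r T" shows "periodic (gcd p r) T"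
proof -
  obtain u v where "u * p + v * r = gcd p r" using bezout_int by blast
  then show ?thesis
    using periodic_add[OF periodic_mult[OF assms(1), of u] periodic_mult[OF assms(2), of v]] by simp
qed

lemma periodic_cong:
  assumes "periodic p T" "p dvd z - w" shows "z \<in> T \<longleftrightarrow> w \<in> T"
  using periodicD[OF periodic_dvd[OF assms], of w] by simp

lemma periodic_mod: "periodic g T \<Longrightarrow> z mod g \<in> T \<longleftrightarrow> z \<in> T"
  by (rule periodic_cong, assumption) (metis mod_eq_dvd_iff mod_mod_trivial)

lemma periodic_translate: "periodic p T \<Longrightarrow> periodic p (translate c T)"
  unfolding periodic_def mem_translate by (metis add_diff_eq diff_add_eq)

lemma periodic_Un: "periodic p S \<Longrightarrow> periodic p T \<Longrightarrow> periodic p (S \<union> T)"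
  and periodic_Int: "periodic p S \<Longrightarrow> periodic p T \<Longrightarrow> periodic p (S \<inter> T)"
  by (auto simp: periodic_def)

lemma mem_sumset: "z \<in> sumset A B \<longleftrightarrow> (\<exists>b\<in>B. z - b \<in> A)"
  unfolding sumset_def by (force intro: exI[of _ "z - _"])

lemma periodic_sumset: "periodic p A \<Longrightarrow> periodic p (sumset A B)"
  unfolding periodic_def mem_sumset by (metis diff_add_eq)

lemma periodic_periodize: "periodic g (periodize g T)"
proof -
  have "g dvd z + g - t \<longleftrightarrow> g dvd z - t" for z t :: int
    using dvd_add_left_iff[of g g "z - t"] by (simp add: algebra_simps)
  then show ?thesis unfolding periodic_def periodize_def by simp
qed

lemma periodize_superset: "T \<subseteq> periodize g T"
  unfolding periodize_def by force

text \<open>The periods of \<open>T\<close> form a subgroup of the integers, and the least positive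
  one generates it: its gcd with any other period is again a positive period.\<close>

lemma minimal_period:
  assumes "periodic g T" "g > 0"
  obtains h where "h > 0" "periodic h T" "\<And>p. periodic p T \<Longrightarrow> h dvd p"
proof -
  define k where "k = (LEAST k. k > 0 \<and> periodic (int k) T)"
  have ex: "nat g > 0 \<and> periodic (int (nat g)) T" using assms by simp
  have k: "k > 0 \<and> periodic (int k) T" unfolding k_def using LeastI[of "\<lambda>k. k > 0 \<and> periodic (int k) T", OF ex] .
  have "int k dvd p" if "periodic p T" for p
  proof -
    have pg: "periodic (gcd (int k) p) T" using periodic_gcd k that by blast
    have pos: "gcd (int k) p > 0" using k by simp
    have "(LEAST k. k > 0 \<and> periodic (int k) T) \<le> nat (gcd (int k) p)"
      using pos pg by (intro Least_le) simp
    then have "int k \<le> gcd (int k) p" using pos k_def by linarith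
    moreover have "gcd (int k) p \<le> int k" using k by (intro gcd_le1_int) simp
    ultimately show ?thesis by (metis gcd_dvd2 order_antisym)
  qed
  then show ?thesis using that[of "int k"] k by simp
qed

section \<open>Counting residue classes\<close>

lemma dens_le: "g \<ge> 0 \<Longrightarrow> dens g T \<le> nat g"
  unfolding dens_def using card_mono[of "{0..<g}" "T \<inter> {0..<g}"] by simp

lemma dens_mono: "S \<subseteq> T \<Longrightarrow> dens g S \<le> dens g T"
  unfolding dens_def by (intro card_mono) auto

lemma dens_Un_Int: "dens g (S \<union> T) + dens g (S \<inter> T) = dens g S + dens g T"
proof -
  have "(S \<union> T) \<inter> {0..<g} = S \<inter> {0..<g} \<union> T \<inter> {0..<g}"
    "S \<inter> T \<inter> {0..<g} = (S \<inter> {0..<g}) \<inter> (T \<inter> {0..<g})" by auto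
  then show ?thesis unfolding dens_def using card_Un_Int[of "S \<inter> {0..<g}" "T \<inter> {0..<g}"] by simp
qed

lemma dens_translate:
  assumes "periodic g T" "g > 0"
  shows "dens g (translate c T) = dens g T"
proof -
  have "bij_betw (\<lambda>z. (z + c) mod g) (T \<inter> {0..<g}) ((translate c T) \<inter> {0..<g})"
  proof (rule bij_betw_byWitness[where f' = "\<lambda>z. (z - c) mod g"])
    show "\<forall>z\<in>T \<inter> {0..<g}. ((z + c) mod g - c) mod g = z"
      using assms by (auto simp: mod_simps)
    show "\<forall>z\<in>translate c T \<inter> {0..<g}. ((z - c) mod g + c) mod g = z"
      using assms by (auto simp: mod_simps)
    show "(\<lambda>z. (z + c) mod g) ` (T \<inter> {0..<g}) \<subseteq> translate c T \<inter> {0..<g}"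
    proof (rule image_subsetI)
      fix z assume "z \<in> T \<inter> {0..<g}"
      then have "z + c \<in> translate c T" by (simp add: mem_translate)
      then show "(z + c) mod g \<in> translate c T \<inter> {0..<g}"
        using assms periodic_mod[OF periodic_translate[OF assms(1), of c]] by simp
    qed
    show "(\<lambda>z. (z - c) mod g) ` (translate c T \<inter> {0..<g}) \<subseteq> T \<inter> {0..<g}"
    proof (rule image_subsetI)
      fix z assume "z \<in> translate c T \<inter> {0..<g}"
      then have "z - c \<in> T" by (simp add: mem_translate)
      then show "(z - c) mod g \<in> T \<inter> {0..<g}" using assms periodic_mod[OF assms(1)] by simp
    qed
  qed
  then show ?thesis unfolding dens_def by (metis bij_betw_same_card)
qed

lemma dens_psubset:
  assumes "periodic g S" "periodic g T" "g > 0" "S \<subseteq> T" "z \<in> T" "z \<notin> S"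
  shows "dens g S < dens g T"
  unfolding dens_def
proof (rule psubset_card_mono)
  have "z mod g \<in> T \<inter> {0..<g}" "z mod g \<notin> S"
    using assms periodic_mod by auto
  then show "S \<inter> {0..<g} \<subset> T \<inter> {0..<g}" using assms(4) by auto
qed simp

lemma dens_residue_class:
  assumes "h > 0" "h dvd g" "g > 0" "periodic g B" "\<And>b. b \<in> B \<Longrightarrow> h dvd b - c"
  shows "dens g B \<le> nat (g div h)"
proof -
  have sub: "(translate (-c) B) \<inter> {0..<g} \<subseteq> (\<lambda>i. h * i) ` {0..<g div h}"
  proof
    fix z assume z: "z \<in> (translate (-c) B) \<inter> {0..<g}"
    then have "h dvd z" using assms(5)[of "z + c"] by (auto simp: mem_translate)
    then obtain i where i: "z = h * i" by blast
    obtain k where k: "g = h * k" using assms(2) by blast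
    have "0 \<le> i" "i < k" using z i k assms(1) by (auto simp: zero_le_mult_iff)
    then show "z \<in> (\<lambda>i. h * i) ` {0..<g div h}" using i k assms(1) by auto
  qed
  have "dens g B = dens g (translate (-c) B)" using dens_translate[OF assms(4,3)] by simp
  also have "\<dots> \<le> card ((\<lambda>i. h * i) ` {0..<g div h})"
    unfolding dens_def by (rule card_mono[OF _ sub]) simp
  also have "\<dots> \<le> card {0..<g div h}" by (rule card_image_le) simp
  finally show ?thesis by simp
qed

text \<open>Dyson's e-transform replaces \<open>A\<close>, \<open>B\<close> by
  \<open>A \<union> (B + e)\<close>, \<open>B \<inter> (A - e)\<close>: the total density is kept,
  \<open>B\<close> shrinks and no new sums arise. When no \<open>e\<close> in \<open>A - B\<close>
  shrinks \<open>B\<close>, the set \<open>A\<close> is invariant under \<open>B - B\<close>, so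
  \<open>B\<close> lies in one class modulo the minimal period \<open>h\<close> of \<open>A\<close>,
  and a translate of \<open>A\<close> serves as \<open>C\<close>.\<close>

lemma weak_kneser:
  assumes "g > 0" "periodic g A" "periodic g B" "A \<noteq> {}" "B \<noteq> {}"
  shows "\<exists>h C. h > 0 \<and> h dvd g \<and> C \<noteq> {} \<and> periodic h C \<and> C \<subseteq> sumset A B \<and>
           dens g A + dens g B \<le> dens g C + nat (g div h)"
  using assms(2-)
proof (induction "dens g B" arbitrary: A B rule: less_induct)
  case less
  show ?case
  proof (cases "\<forall>a\<in>A. \<forall>b\<in>B. \<forall>b'\<in>B. a + (b - b') \<in> A")
    case True
    obtain b0 where b0: "b0 \<in> B" using less.prems by blast
    obtain h where h: "h > 0" "periodic h A" "\<And>p. periodic p A \<Longrightarrow> h dvd p"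
      using minimal_period[OF less.prems(1) assms(1)] by blast
    have "periodic (b - b') A" if "b \<in> B" "b' \<in> B" for b b'
      unfolding periodic_def
    proof (intro allI iffI)
      fix z assume "z + (b - b') \<in> A"
      then have "z + (b - b') + (b' - b) \<in> A" using True that by blast
      then show "z \<in> A" by simp
    qed (use True that in blast)
    then have "dens g B \<le> nat (g div h)"
      using dens_residue_class[OF h(1) h(3)[OF less.prems(1)] assms(1) less.prems(2), of b0] h(3) b0
      by blast
    moreover have "dens g (translate b0 A) = dens g A" by (rule dens_translate[OF less.prems(1) assms(1)])
    moreover have "translate b0 A \<noteq> {}"
      using less.prems(3) mem_translate[of "_ + b0" b0 A] by fastforce
    moreover have "translate b0 A \<subseteq> sumset A B" using b0 by (auto simp: mem_sumset mem_translate)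
    ultimately show ?thesis
      using h h(3)[OF less.prems(1)] less.prems(3) periodic_translate[OF h(2)]
      by (intro exI[of _ h] exI[of _ "translate b0 A"]) auto
  next
    case False
    then obtain a b b' where abb: "a \<in> A" "b \<in> B" "b' \<in> B" "a + (b - b') \<notin> A" by blast
    \<comment> \<open>Adding this \<open>e\<close> sends \<open>b'\<close> into \<open>A\<close> and
      \<open>b\<close> outside it, so \<open>B2\<close> is nonempty and strictly smaller than
      \<open>B\<close>.\<close>
    define e where "e = a - b'"
    define A2 where "A2 = A \<union> translate e B"
    define B2 where "B2 = B \<inter> translate (- e) A"
    have pA: "periodic g A2" and pB: "periodic g B2"
      unfolding A2_def B2_def
      by (intro periodic_Un periodic_Int periodic_translate less.prems)+
    have b': "b' \<in> B2" using abb by (simp add: B2_def mem_translate e_def)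
    have "b \<notin> B2" using abb by (simp add: B2_def mem_translate e_def algebra_simps)
    then have lt: "dens g B2 < dens g B"
      using dens_psubset[OF pB less.prems(2) assms(1)] abb by (auto simp: B2_def)
    have "A \<inter> translate e B = translate e B2" unfolding B2_def by (auto simp: mem_translate)
    then have "dens g (A \<inter> translate e B) = dens g B2" using dens_translate[OF pB assms(1)] by simp
    moreover have "dens g (translate e B) = dens g B" by (rule dens_translate[OF less.prems(2) assms(1)])
    ultimately have eq: "dens g A2 + dens g B2 = dens g A + dens g B"
      using dens_Un_Int[of g A "translate e B"] by (simp add: A2_def)
    have sub: "sumset A2 B2 \<subseteq> sumset A B"
    proof
      fix z assume "z \<in> sumset A2 B2"
      then obtain x y where xy: "z = x + y" "x \<in> A2" "y \<in> B2" unfolding sumset_def by blast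
      show "z \<in> sumset A B"
      proof (cases "x \<in> A")
        case True
        then show ?thesis using xy unfolding sumset_def B2_def by blast
      next
        case False
        then have "x - e \<in> B" "y + e \<in> A" using xy by (auto simp: A2_def B2_def mem_translate)
        moreover have "z = (y + e) + (x - e)" using xy by simp
        ultimately show ?thesis unfolding sumset_def by blast
      qed
    qed
    have "A2 \<noteq> {}" "B2 \<noteq> {}" using abb b' by (auto simp: A2_def)
    then show ?thesis using less.hyps[OF lt pA pB] eq sub by (metis subset_trans)
  qed
qed

primrec sums_upto :: "(nat \<Rightarrow> int set) \<Rightarrow> nat \<Rightarrow> int set" where
  "sums_upto D 0 = {0}"
| "sums_upto D (Suc s) = sumset (sums_upto D s) (D s)"

lemma sumset_periodize: "periodic h C \<Longrightarrow> sumset C (periodize h D) \<subseteq> sumset C D"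
proof
  fix z assume C: "periodic h C" and "z \<in> sumset C (periodize h D)"
  then obtain b t where b: "t \<in> D" "h dvd b - t" "z - b \<in> C" unfolding mem_sumset periodize_def by blast
  have "z - t \<in> C" using periodic_cong[OF C, of "z - t" "z - b"] b by simp
  then show "z \<in> sumset C D" unfolding mem_sumset using b by blast
qed

lemma periodize_mono_dvd: "h dvd g \<Longrightarrow> periodize g T \<subseteq> periodize h T"
  unfolding periodize_def by (auto intro: dvd_trans)

lemma sumset_periodize_left: "sumset (periodize g S) D \<subseteq> periodize g (sumset S D)"
proof
  fix z assume "z \<in> sumset (periodize g S) D"
  then obtain b t where b: "b \<in> D" "t \<in> S" "g dvd z - b - t" unfolding mem_sumset periodize_def by blast
  then have "t + b \<in> sumset S D" "g dvd z - (t + b)"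
    unfolding sumset_def by (blast, simp add: algebra_simps)
  then show "z \<in> periodize g (sumset S D)" unfolding periodize_def by blast
qed

lemma sumset_mono: "A \<subseteq> A' \<Longrightarrow> sumset A B \<subseteq> sumset A' B"
  unfolding sumset_def by blast

text \<open>Each application of \<open>weak_kneser\<close> loses at most \<open>g div h\<close> for
  its own \<open>h\<close>. Keeping the smallest period met so far bounds every loss by the same
  quantity, whence the factor \<open>s\<close>.\<close>

lemma weak_kneser_many:
  assumes "g > 0" "\<And>j. j < s \<Longrightarrow> D j \<noteq> {}"
  shows "\<exists>h C. h > 0 \<and> h dvd g \<and> C \<noteq> {} \<and> periodic h C \<and> C \<subseteq> periodize g (sums_upto D s) \<and>
           (\<Sum>j<s. dens g (periodize g (D j))) \<le> dens g C + s * nat (g div h)"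
  using assms(2)
proof (induction s)
  case 0
  show ?case using assms(1) periodic_periodize periodize_superset[of "{0}" g]
    by (intro exI[of _ g] exI[of _ "periodize g {0}"]) auto
next
  case (Suc s)
  then obtain h C where hC: "h > 0" "h dvd g" "C \<noteq> {}" "periodic h C" "C \<subseteq> periodize g (sums_upto D s)"
    and le: "(\<Sum>j<s. dens g (periodize g (D j))) \<le> dens g C + s * nat (g div h)"
    by (metis less_SucI)
  define B where "B = periodize h (D s)"
  have "B \<noteq> {}" using periodize_superset[of "D s" h] Suc.prems[of s] by (auto simp: B_def)
  moreover have "periodic g B" "periodic g C"
    using periodic_dvd[OF _ hC(2)] hC(4) periodic_periodize by (auto simp: B_def)
  ultimately obtain h2 C2 where h2: "h2 > 0" "h2 dvd g" "C2 \<noteq> {}" "periodic h2 C2" "C2 \<subseteq> sumset C B"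
    "dens g C + dens g B \<le> dens g C2 + nat (g div h2)"
    using weak_kneser[OF assms(1), of C B] hC(3) by blast
  have sub: "sumset C B \<subseteq> sumset C (D s)" unfolding B_def by (rule sumset_periodize[OF hC(4)])
  have sub2: "sumset C (D s) \<subseteq> periodize g (sums_upto D (Suc s))"
    using sumset_mono[OF hC(5)] sumset_periodize_left by force
  have dB: "dens g (periodize g (D s)) \<le> dens g B"
    unfolding B_def by (intro dens_mono periodize_mono_dvd hC)
  show ?case
  proof (cases "nat (g div h) \<le> nat (g div h2)")
    case True
    then have "s * nat (g div h) \<le> s * nat (g div h2)" by (rule mult_le_mono2)
    then have "(\<Sum>j<Suc s. dens g (periodize g (D j))) \<le> dens g C2 + Suc s * nat (g div h2)"
      using le h2(6) dB unfolding sum.lessThan_Suc mult_Suc by linarith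
    then show ?thesis using h2 sub sub2 by blast
  next
    case False
    \<comment> \<open>The new period is larger here, so the old \<open>h\<close> is kept: the full
      sumset of \<open>C\<close> and \<open>D s\<close> contains \<open>C2\<close> and inherits the
      period \<open>h\<close>.\<close>
    define C' where "C' = sumset C (D s)"
    have "dens g C2 \<le> dens g C'" unfolding C'_def using h2(5) sub by (intro dens_mono) auto
    then have "(\<Sum>j<Suc s. dens g (periodize g (D j))) \<le> dens g C' + Suc s * nat (g div h)"
      using le h2(6) dB False unfolding sum.lessThan_Suc mult_Suc by linarith
    moreover have "C' \<noteq> {}" using h2(3,5) sub by (auto simp: C'_def)
    moreover have "periodic h C'" unfolding C'_def by (rule periodic_sumset[OF hC(4)])
    ultimately show ?thesis using hC sub2 unfolding C'_def by blast
  qed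
qed

text \<open>\<open>C\<close> has density at most \<open>g\<close>, so densities totalling
  \<open>2 * g\<close> leave \<open>g <= s * (g div h)\<close>, that is \<open>h <= s\<close>. Being
  nonempty and \<open>h\<close>-periodic, \<open>C\<close> contains a full class modulo
  \<open>h\<close>.\<close>

lemma sums_cover_residue_class:
  assumes "g > 0" "\<And>j. j < s \<Longrightarrow> D j \<noteq> {}"
    and "2 * nat g \<le> (\<Sum>j<s. dens g (periodize g (D j)))"
  obtains h c where "h > 0" "h \<le> int s" "h dvd g"
    "\<And>z. h dvd z - c \<Longrightarrow> \<exists>w\<in>sums_upto D s. g dvd z - w"
proof -
  obtain h C where hC: "h > 0" "h dvd g" "C \<noteq> {}" "periodic h C" "C \<subseteq> periodize g (sums_upto D s)"
    and le: "(\<Sum>j<s. dens g (periodize g (D j))) \<le> dens g C + s * nat (g div h)"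
    using weak_kneser_many[of g s D] assms(1,2) by metis
  obtain k where k: "g = h * k" using hC(2) by blast
  have "k > 0" using k hC(1) assms(1) by (simp add: zero_less_mult_iff)
  have "g div h = k" using k hC(1) by simp
  moreover have "dens g C \<le> nat g" using dens_le assms(1) by simp
  ultimately have "nat g \<le> s * nat k" using le assms(3) by simp
  then have "int (nat g) \<le> int (s * nat k)" by (simp only: of_nat_le_iff)
  then have "h * k \<le> int s * k" using k assms(1) \<open>k > 0\<close> by simp
  then have "h \<le> int s" using \<open>k > 0\<close> by simp
  obtain c where "c \<in> C" using hC(3) by blast
  have "\<exists>w\<in>sums_upto D s. g dvd z - w" if "h dvd z - c" for z
    using periodic_cong[OF hC(4) that] \<open>c \<in> C\<close> hC(5) unfolding periodize_def by blast
  then show ?thesis using that hC \<open>h \<le> int s\<close> by blast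
qed

text \<open>An element \<open>z\<close> is determined by its residue modulo \<open>g\<close> and by
  \<open>(z - y) div g\<close>, which takes at most \<open>w div g + 1\<close> values.\<close>

lemma card_le_dens_periodize:
  assumes "g > 0" "D \<subseteq> {y..y + w}" "w \<ge> 0"
  shows "int (card D) \<le> int (dens g (periodize g D)) * (w div g + 1)"
proof -
  let ?f = "\<lambda>z. (z mod g, (z - y) div g)"
  have "inj_on ?f D"
  proof (rule inj_onI)
    fix z z' assume "z \<in> D" "z' \<in> D" and eq: "?f z = ?f z'"
    then have "(z - y) mod g = (z' - y) mod g" by (metis Pair_inject mod_diff_left_eq)
    then show "z = z'" using eq by (metis Pair_inject div_mult_mod_eq diff_add_cancel)
  qed
  moreover have "?f ` D \<subseteq> (periodize g D \<inter> {0..<g}) \<times> {0..w div g}"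
  proof (rule image_subsetI)
    fix z assume z: "z \<in> D"
    have "z mod g \<in> periodize g D"
      using periodic_mod[OF periodic_periodize] periodize_superset z by blast
    then show "?f z \<in> (periodize g D \<inter> {0..<g}) \<times> {0..w div g}"
      using assms z by (auto simp: pos_imp_zdiv_nonneg_iff intro!: zdiv_mono1)
  qed
  ultimately have "card D \<le> card ((periodize g D \<inter> {0..<g}) \<times> {0..w div g})"
    by (intro card_inj_on_le) auto
  also have "\<dots> = dens g (periodize g D) * nat (w div g + 1)"
    by (simp add: dens_def card_cartesian_product)
  finally have "int (card D) \<le> int (dens g (periodize g D) * nat (w div g + 1))" by linarith
  then show ?thesis using assms by (simp add: pos_imp_zdiv_nonneg_iff)
qed

section \<open>Popular pair sums\<close>

definition ssum :: "nat \<Rightarrow> int set \<Rightarrow> int set" where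
  "ssum k B = {\<Sum>S | S. S \<subseteq> B \<and> finite S \<and> card S = k}"

lemma ssum_mono: "A \<subseteq> B \<Longrightarrow> ssum k A \<subseteq> ssum k B"
  unfolding ssum_def by blast

lemma ssum_add:
  assumes "x \<in> ssum k A" "y \<in> ssum j B" "A \<inter> B = {}"
  shows "x + y \<in> ssum (k + j) (A \<union> B)"
proof -
  obtain S T where S: "x = \<Sum>S" "S \<subseteq> A" "finite S" "card S = k"
    and T: "y = \<Sum>T" "T \<subseteq> B" "finite T" "card T = j"
    using assms unfolding ssum_def by blast
  have "S \<inter> T = {}" using S T assms by blast
  then have "x + y = \<Sum>(S \<union> T)" "card (S \<union> T) = k + j"
    using S T by (simp_all add: sum.union_disjoint card_Un_disjoint)
  then show ?thesis unfolding ssum_def using S T by blast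
qed

lemma ssum_single: "b \<in> B \<Longrightarrow> b \<in> ssum 1 B"
  unfolding ssum_def by (intro CollectI exI[of _ "{b}"]) auto

lemma ssum_bounds:
  assumes "z \<in> ssum k B" "B \<subseteq> {x..x + l}"
  shows "int k * x \<le> z \<and> z \<le> int k * (x + l)"
proof -
  obtain S where S: "z = \<Sum>S" "S \<subseteq> B" "finite S" "card S = k" using assms unfolding ssum_def by blast
  have "int (card S) * x \<le> \<Sum>S" using S assms by (intro sum_bounded_below) auto
  moreover have "\<Sum>S \<le> int (card S) * (x + l)" using S assms by (intro sum_bounded_above) auto
  ultimately show ?thesis using S by simp
qed

text \<open>A pair is recorded by its smaller element, so each unordered pair of distinct elements
  with sum \<open>s\<close> is counted once.\<close>

definition pair_reps :: "int set \<Rightarrow> int \<Rightarrow> int set" where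
  "pair_reps B s = {a \<in> B. a < s - a \<and> s - a \<in> B}"

definition popular :: "int set \<Rightarrow> nat \<Rightarrow> int set" where
  "popular B j = {s. 2 * j + 1 \<le> card (pair_reps B s)}"

lemma pair_reps_finite: "finite B \<Longrightarrow> finite (pair_reps B s)"
  unfolding pair_reps_def by simp

text \<open>Pairs with the same sum are disjoint, so each element of \<open>S\<close> meets at most
  one of them.\<close>

lemma pair_reps_avoid:
  assumes "finite S" "card S < card (pair_reps B s)"
  shows "\<exists>a\<in>pair_reps B s. a \<notin> S \<and> s - a \<notin> S"
proof (rule ccontr)
  assume "\<not> ?thesis"
  then have all: "a \<in> S \<or> s - a \<in> S" if "a \<in> pair_reps B s" for a
    using that by blast
  let ?f = "\<lambda>a. if a \<in> S then a else s - a"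
  have "inj_on ?f (pair_reps B s)"
    by (rule inj_onI) (auto simp: pair_reps_def split: if_splits)
  moreover have "?f ` pair_reps B s \<subseteq> S" using all by auto
  ultimately have "card (pair_reps B s) \<le> card S" using assms(1) by (intro card_inj_on_le)
  then show False using assms(2) by simp
qed

text \<open>Each choice blocks at most as many pairs as there are elements used so far, so a sum
  with more than \<open>2 j\<close> representations can be chosen in the \<open>j\<close>-th step.\<close>
lemma sums_of_popular:
  "z \<in> sums_upto (popular B) t \<Longrightarrow> z \<in> ssum (2 * t) B"
proof (induction t arbitrary: z)
  case 0
  then show ?case by (auto simp: ssum_def intro: exI[of _ "{}"])
next
  case (Suc t)
  then obtain w s where z: "z = w + s" "w \<in> sums_upto (popular B) t" "s \<in> popular B t"
    by (auto simp: sumset_def)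
  obtain S where S: "w = \<Sum>S" "S \<subseteq> B" "finite S" "card S = 2 * t"
    using Suc.IH[OF z(2)] unfolding ssum_def by blast
  obtain a where a: "a \<in> pair_reps B s" "a \<notin> S" "s - a \<notin> S"
    using pair_reps_avoid[OF S(3), of B s] z(3) S(4) by (auto simp: popular_def)
  have "a \<noteq> s - a" "a \<in> B" "s - a \<in> B" using a(1) by (auto simp: pair_reps_def)
  then have "z = \<Sum>(insert a (insert (s - a) S))" "card (insert a (insert (s - a) S)) = 2 * Suc t"
    using a z S by auto
  then show ?case unfolding ssum_def using S \<open>a \<in> B\<close> \<open>s - a \<in> B\<close>
    by (intro CollectI exI[of _ "insert a (insert (s - a) S)"]) auto
qed

section \<open>Double counting of pair sums\<close>

lemma popular_antimono: "i \<le> j \<Longrightarrow> popular B j \<subseteq> popular B i"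
  unfolding popular_def by auto

lemma popular_range: "B \<subseteq> {x..x + l} \<Longrightarrow> popular B j \<subseteq> {2 * x..2 * x + 2 * l}"
proof
  fix s assume B: "B \<subseteq> {x..x + l}" and "s \<in> popular B j"
  then have "pair_reps B s \<noteq> {}" by (auto simp: popular_def)
  then obtain a where "a \<in> B" "s - a \<in> B" by (auto simp: pair_reps_def)
  then have "x \<le> a" "a \<le> x + l" "x \<le> s - a" "s - a \<le> x + l" using B by auto
  then show "s \<in> {2 * x..2 * x + 2 * l}" by auto
qed

lemma card_lt_pairs:
  fixes B :: "int set"
  assumes "finite B"
  shows "2 * card {(a, b). a \<in> B \<and> b \<in> B \<and> a < b} + card B = card B * card B"
proof -
  let ?L = "{(a, b). a \<in> B \<and> b \<in> B \<and> a < b}"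
  let ?G = "{(a, b). a \<in> B \<and> b \<in> B \<and> b < a}"
  let ?E = "(\<lambda>a. (a, a)) ` B"
  have fin: "finite ?L" "finite ?G" "finite ?E"
    using assms by (auto intro: finite_subset[of _ "B \<times> B"])
  have "card ?G = card (prod.swap ` ?L)" by (rule arg_cong[of _ _ card]) (auto simp: image_iff)
  also have "\<dots> = card ?L" by (intro card_image) (auto simp: inj_on_def)
  finally have G: "card ?G = card ?L" .
  have E: "card ?E = card B" by (intro card_image) (auto simp: inj_on_def)
  have "B \<times> B = (?L \<union> ?G) \<union> ?E" by auto
  then have "card (B \<times> B) = card ((?L \<union> ?G) \<union> ?E)" by simp
  also have "\<dots> = card (?L \<union> ?G) + card ?E" using fin by (intro card_Un_disjoint) auto
  also have "card (?L \<union> ?G) = card ?L + card ?G" using fin by (intro card_Un_disjoint) auto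
  finally show ?thesis using G E by (simp add: card_cartesian_product)
qed

lemma sum_card_swap:
  assumes "finite I" "finite Y" "\<And>j. j \<in> I \<Longrightarrow> F j \<subseteq> Y"
  shows "(\<Sum>j\<in>I. card (F j)) = (\<Sum>s\<in>Y. card {j \<in> I. s \<in> F j})"
proof -
  have "card (F j) = (\<Sum>s\<in>Y. of_bool (s \<in> F j))" if "j \<in> I" for j
  proof -
    have "F j = Y \<inter> {s. s \<in> F j}" using assms(3)[OF that] by blast
    then show ?thesis using assms(2) by (simp add: sum_of_bool_eq)
  qed
  then have "(\<Sum>j\<in>I. card (F j)) = (\<Sum>j\<in>I. \<Sum>s\<in>Y. of_bool (s \<in> F j))" by simp
  also have "\<dots> = (\<Sum>s\<in>Y. \<Sum>j\<in>I. of_bool (s \<in> F j))" by (rule sum.swap)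
  also have "\<dots> = (\<Sum>s\<in>Y. card {j \<in> I. s \<in> F j})"
    using assms(1) by (intro sum.cong refl) (simp add: sum_of_bool_eq Int_def)
  finally show ?thesis .
qed

lemma sum_card_pair_reps:
  assumes "finite B" "finite Y"
  shows "(\<Sum>s\<in>Y. card (pair_reps B s)) = card {(a, b). a \<in> B \<and> b \<in> B \<and> a < b \<and> a + b \<in> Y}"
proof -
  have "(\<Sum>s\<in>Y. card (pair_reps B s)) = card (Sigma Y (pair_reps B))"
    using assms by (simp add: card_SigmaI pair_reps_finite)
  also have "\<dots> = card {(a, b). a \<in> B \<and> b \<in> B \<and> a < b \<and> a + b \<in> Y}"
    by (rule bij_betw_same_card[of "\<lambda>(s, a). (a, s - a)"],
        rule bij_betw_byWitness[where f' = "\<lambda>(a, b). (a + b, a)"])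
       (auto simp: pair_reps_def)
  finally show ?thesis .
qed

lemma card_odd_le: "card {j. j < M \<and> 2 * j + 1 \<le> r} \<le> (r::nat)"
proof -
  have "{j. j < M \<and> 2 * j + 1 \<le> r} \<subseteq> {..<r}" by auto
  from card_mono[OF _ this] show ?thesis by simp
qed

text \<open>A sum with \<open>r\<close> representations lies in about \<open>r / 2\<close> of the
  sets \<open>popular B j\<close>; this bound and \<open>card_odd_le\<close> convert between the
  sizes of these sets and numbers of pairs.\<close>

lemma card_odd_ge:
  assumes "r \<le> (M::nat)"
  shows "r \<le> 2 * card {j. j < M \<and> 2 * j + 1 \<le> r}"
proof -
  have "{..<(r + 1) div 2} \<subseteq> {j. j < M \<and> 2 * j + 1 \<le> r}" using assms by auto
  then have "card {..<(r + 1) div 2} \<le> card {j. j < M \<and> 2 * j + 1 \<le> r}" by (intro card_mono) auto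
  then show ?thesis by simp
qed

lemma sum_card_popular:
  assumes "finite B"
  shows "card B * card B \<le> 4 * (\<Sum>j<card B. card (popular B j)) + card B"
proof (cases "B = {}")
  case False
  define M where "M = card B"
  have B: "B \<subseteq> {Min B..Min B + (Max B - Min B)}" using assms by auto
  define Y where "Y = {2 * Min B..2 * Min B + 2 * (Max B - Min B)}"
  have "card (pair_reps B s) \<le> M" for s
    unfolding M_def by (intro card_mono assms) (auto simp: pair_reps_def)
  then have "(\<Sum>s\<in>Y. card (pair_reps B s)) \<le> (\<Sum>s\<in>Y. 2 * card {j. j < M \<and> 2 * j + 1 \<le> card (pair_reps B s)})"
    by (intro sum_mono card_odd_ge)
  also have "\<dots> = 2 * (\<Sum>s\<in>Y. card {j \<in> {..<M}. s \<in> popular B j})"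
    by (simp add: sum_distrib_left popular_def)
  also have "(\<Sum>s\<in>Y. card {j \<in> {..<M}. s \<in> popular B j}) = (\<Sum>j<M. card (popular B j))"
    using popular_range[OF B] unfolding Y_def by (intro sum_card_swap[symmetric]) auto
  finally have 1: "(\<Sum>s\<in>Y. card (pair_reps B s)) \<le> 2 * (\<Sum>j<M. card (popular B j))" .
  have "{(a, b). a \<in> B \<and> b \<in> B \<and> a < b \<and> a + b \<in> Y} = {(a, b). a \<in> B \<and> b \<in> B \<and> a < b}"
  proof -
    have "a + b \<in> Y" if "a \<in> B" "b \<in> B" for a b
      using Min_le[OF assms that(1)] Min_le[OF assms that(2)] Max_ge[OF assms that(1)]
        Max_ge[OF assms that(2)] unfolding Y_def by auto
    then show ?thesis by auto
  qed
  moreover have "finite Y" by (simp add: Y_def)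
  ultimately show ?thesis
    using 1 sum_card_pair_reps[OF assms, of Y] card_lt_pairs[OF assms] unfolding M_def by simp
qed simp

text \<open>All \<open>popular B j\<close> with \<open>j >= t\<close> lie in the window of
  \<open>popular B t\<close>. A pair with its sum there is given by \<open>a\<close> and a partner
  in a translated window of length \<open>w\<close>, which leaves at most \<open>W\<close> choices
  for the partner.\<close>

lemma sum_card_popular_window:
  assumes "finite B" "popular B t \<subseteq> {y..y + w}" "\<And>z. card (B \<inter> {z..z + w}) \<le> W"
  shows "(\<Sum>j\<in>{t..<M}. card (popular B j)) \<le> card B * W"
proof -
  let ?Y = "{y..y + w}"
  have "(\<Sum>j\<in>{t..<M}. card (popular B j)) = (\<Sum>s\<in>?Y. card {j \<in> {t..<M}. s \<in> popular B j})"
    using assms(2) popular_antimono by (intro sum_card_swap) fastforce+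
  also have "\<dots> \<le> (\<Sum>s\<in>?Y. card (pair_reps B s))"
  proof (rule sum_mono)
    fix s
    have "card {j \<in> {t..<M}. s \<in> popular B j} \<le> card {j. j < M \<and> 2 * j + 1 \<le> card (pair_reps B s)}"
      by (intro card_mono) (auto simp: popular_def)
    also have "\<dots> \<le> card (pair_reps B s)" by (rule card_odd_le)
    finally show "card {j \<in> {t..<M}. s \<in> popular B j} \<le> card (pair_reps B s)" .
  qed
  also have "\<dots> = card {(a, b). a \<in> B \<and> b \<in> B \<and> a < b \<and> a + b \<in> ?Y}"
    by (rule sum_card_pair_reps[OF assms(1)]) simp
  also have "\<dots> \<le> card (Sigma B (\<lambda>a. B \<inter> {y - a..y - a + w}))"
    using assms(1) by (intro card_mono finite_SigmaI) auto
  also have "\<dots> = (\<Sum>a\<in>B. card (B \<inter> {y - a..y - a + w}))"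
    using assms(1) by (simp add: card_SigmaI)
  also have "\<dots> \<le> (\<Sum>a\<in>B. W)" by (intro sum_mono assms(3))
  finally show ?thesis by simp
qed

section \<open>Arithmetic progressions in subset sums\<close>

definition ap :: "int \<Rightarrow> int \<Rightarrow> int \<Rightarrow> int set" where
  "ap a q L = (\<lambda>i. a + q * i) ` {0..L}"

lemma mem_ap:
  assumes "q > 0" "q dvd z - a" "a \<le> z" "z \<le> a + q * L"
  shows "z \<in> ap a q L"
proof -
  obtain i where i: "z - a = q * i" using assms(2) by blast
  then have "0 \<le> q * i" "q * i \<le> q * L" using assms by linarith+
  then have "0 \<le> i" "i \<le> L" using assms(1) by (auto simp: zero_le_mult_iff)
  then show ?thesis unfolding ap_def using i by (intro image_eqI[of _ _ i]) auto
qed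

lemma apI: "0 \<le> i \<Longrightarrow> i \<le> L \<Longrightarrow> a + q * i \<in> ap a q L"
  unfolding ap_def by (rule image_eqI[of _ _ i]) auto

lemma ap_mono: "L \<le> L' \<Longrightarrow> ap a q L \<subseteq> ap a q L'"
  unfolding ap_def by auto

section \<open>Lengthening progressions by congruent pairs\<close>

lemma window_diff: "B \<subseteq> {x..x + l} \<Longrightarrow> b \<in> B \<Longrightarrow> b' \<in> B \<Longrightarrow> b - b' \<le> (l::int)"
  using atLeastAtMost_iff[of b x "x + l"] atLeastAtMost_iff[of b' x "x + l"] by fastforce

lemma card_residue_class_le:
  assumes "finite B" "B \<noteq> {}" "q > 0" "\<And>b b'. b \<in> B \<Longrightarrow> b' \<in> B \<Longrightarrow> q dvd b - b'"
  shows "q * (int (card B) - 1) \<le> Max B - Min B"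
proof -
  have m: "Min B \<in> B" "Max B \<in> B" using assms by auto
  obtain d where d: "Max B - Min B = q * d" using assms(4)[OF m(2,1)] by blast
  have "d \<ge> 0" using d m assms by (metis Min_le diff_ge_0_iff_ge zero_le_mult_iff not_less)
  have "B \<subseteq> ap (Min B) q d"
  proof
    fix b assume b: "b \<in> B"
    have "Min B \<le> b" "b \<le> Min B + q * d" using d Min_le[OF assms(1) b] Max_ge[OF assms(1) b] by linarith+
    then show "b \<in> ap (Min B) q d" by (rule mem_ap[OF assms(3) assms(4)[OF b m(1)]])
  qed
  then have "card B \<le> card (ap (Min B) q d)" by (intro card_mono) (auto simp: ap_def)
  also have "\<dots> \<le> card {0..d}" unfolding ap_def by (rule card_image_le) simp
  finally have "int (card B) - 1 \<le> d" using \<open>d \<ge> 0\<close> by simp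
  then show ?thesis using d assms(3) by simp
qed

text \<open>A pair of elements that are congruent modulo the difference of the progression
  lengthens it; the least and the greatest remaining element are far apart.\<close>
lemma ap_extend:
  assumes "q > 0" "finite B" "\<And>b b'. b \<in> B \<Longrightarrow> b' \<in> B \<Longrightarrow> q dvd b - b'"
    "B \<subseteq> {x..x + l}" "l \<le> q * L" "S \<inter> B = {}" "ap a q L \<subseteq> ssum k S" "2 * P + w + 1 \<le> card B"
  shows "\<exists>a'. ap a' q (L + int P * int w) \<subseteq> ssum (k + P) (S \<union> B)"
  using assms(2-)
proof (induction P arbitrary: B L S a k)
  case 0
  then show ?case using ssum_mono[of S "S \<union> B" k] by (intro exI[of _ a]) simp
next
  case (Suc P)
  have ne: "B \<noteq> {}" using Suc.prems by auto
  define lo hi where "lo = Min B" and "hi = Max B"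
  have m: "lo \<in> B" "hi \<in> B" using ne Suc.prems(1) by (auto simp: lo_def hi_def)
  obtain d where d: "hi - lo = q * d" using Suc.prems(2)[OF m(2,1)] by blast
  have "q * (int (card B) - 1) \<le> q * d"
    using card_residue_class_le[OF Suc.prems(1) ne assms(1) Suc.prems(2)] d by (simp add: lo_def hi_def)
  \<comment> \<open>The extreme elements differ by \<open>q * d\<close> with
    \<open>w <= d <= L\<close>: the two shifted copies of the progression leave no gap, and their
    union is longer by \<open>d\<close> steps.\<close>
  then have dw: "int w \<le> d" "0 < d" using assms(1) Suc.prems(7) by auto
  have "hi - lo \<le> l" using window_diff[OF Suc.prems(3) m(2,1)] .
  then have "q * d \<le> q * L" using d Suc.prems(4) by simp
  then have dL: "d \<le> L" using assms(1) by simp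
  have step: "ap (a + lo) q (L + int w) \<subseteq> ssum (k + 1) (S \<union> {lo, hi})"
  proof
    fix z assume "z \<in> ap (a + lo) q (L + int w)"
    then obtain i where i: "0 \<le> i" "i \<le> L + int w" "z = a + lo + q * i" by (auto simp: ap_def)
    have disj: "S \<inter> {lo, hi} = {}" using Suc.prems(5) m by auto
    show "z \<in> ssum (k + 1) (S \<union> {lo, hi})"
    proof (cases "i \<le> L")
      case True
      then have "a + q * i \<in> ssum k S" using Suc.prems(6) apI i by blast
      from ssum_add[OF this ssum_single[of lo "{lo, hi}"] disj] show ?thesis using i by (simp add: algebra_simps)
    next
      case False
      then have "0 \<le> i - d" "i - d \<le> L" using dL dw i by auto
      then have "a + q * (i - d) \<in> ssum k S" using Suc.prems(6) apI by blast
      from ssum_add[OF this ssum_single[of hi "{lo, hi}"] disj]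
      have "a + q * (i - d) + hi \<in> ssum (k + 1) (S \<union> {lo, hi})" by simp
      moreover have "a + q * (i - d) + hi = z" using i d by (simp add: algebra_simps)
      ultimately show ?thesis by simp
    qed
  qed
  let ?B = "B - {lo, hi}"
  have "card {lo, hi} \<le> 2" by (simp add: card_insert_le_m1)
  then have c: "2 * P + w + 1 \<le> card ?B"
    using Suc.prems(7) diff_card_le_card_Diff[of "{lo, hi}" B] by simp
  have "q * L \<le> q * (L + int w)" using assms(1) by simp
  then have "l \<le> q * (L + int w)" using Suc.prems(4) by linarith
  then obtain a' where "ap a' q (L + int w + int P * int w) \<subseteq> ssum (k + 1 + P) (S \<union> {lo, hi} \<union> ?B)"
    using Suc.IH[OF _ _ _ _ _ step c] Suc.prems(1-3,5) by blast
  moreover have "S \<union> {lo, hi} \<union> ?B = S \<union> B" using m by blast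
  moreover have "L + int w + int P * int w = L + int (Suc P) * int w" by (simp add: algebra_simps)
  ultimately show ?case by (intro exI[of _ a']) simp
qed

text \<open>\<open>T\<close> holds residues reached by sums of \<open>u\<close> elements of
  \<open>U\<close>, one from each of \<open>u\<close> pairs. If \<open>b - b'\<close> is not a
  period of \<open>T\<close>, the pair \<open>b\<close>, \<open>b'\<close> turns it into
  \<open>(T + b) \<union> (T + b')\<close>, which is strictly larger; this happens fewer than
  \<open>q0\<close> times.\<close>

lemma pair_fill_step:
  assumes "q0 > 0" "finite B" "U \<subseteq> B" "card U = 2 * u" "u + 1 \<le> dens q0 T" "periodic q0 T"
    "\<And>z. z \<in> T \<Longrightarrow> \<exists>w\<in>ssum u U. q0 dvd z - w"
  shows "\<exists>U u T. U \<subseteq> B \<and> card U = 2 * u \<and> u + 1 \<le> dens q0 T \<and> periodic q0 T \<and>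
    (\<forall>z\<in>T. \<exists>w\<in>ssum u U. q0 dvd z - w) \<and> (\<forall>b\<in>B - U. \<forall>b'\<in>B - U. periodic (b - b') T)"
  using assms(3-)
proof (induction "nat q0 - dens q0 T" arbitrary: U u T rule: less_induct)
  case less
  show ?case
  proof (cases "\<forall>b\<in>B - U. \<forall>b'\<in>B - U. periodic (b - b') T")
    case True
    then show ?thesis using less.prems by blast
  next
    case False
    then obtain b b' where b: "b \<in> B - U" "b' \<in> B - U" "\<not> periodic (b - b') T" by blast
    define T' where "T' = translate b T \<union> translate b' T"
    have per: "periodic q0 (translate b T)" "periodic q0 (translate b' T)" "periodic q0 T'"
      unfolding T'_def by (intro periodic_Un periodic_translate less.prems)+
    obtain z where z: "(z + (b - b') \<in> T) \<noteq> (z \<in> T)" using b(3) unfolding periodic_def by blast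
    have "dens q0 T < dens q0 T'"
    proof (cases "z \<in> T")
      case True
      then have "z + b \<in> T'" "z + b \<notin> translate b' T"
        using z by (auto simp: T'_def mem_translate algebra_simps)
      then have "dens q0 (translate b' T) < dens q0 T'"
        using dens_psubset[OF per(2,3) assms(1)] by (auto simp: T'_def)
      then show ?thesis using dens_translate[OF less.prems(4) assms(1)] by simp
    next
      case False
      then have "z + b \<in> T'" "z + b \<notin> translate b T"
        using z by (auto simp: T'_def mem_translate algebra_simps)
      then have "dens q0 (translate b T) < dens q0 T'"
        using dens_psubset[OF per(1,3) assms(1)] by (auto simp: T'_def)
      then show ?thesis using dens_translate[OF less.prems(4) assms(1)] by simp
    qed
    moreover have "dens q0 T' \<le> nat q0" using dens_le assms(1) by simp
    ultimately have lt: "nat q0 - dens q0 T' < nat q0 - dens q0 T" "u + 1 + 1 \<le> dens q0 T'"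
      using less.prems(3) by linarith+
    have "b \<noteq> b'" using b(3) by (auto simp: periodic_def)
    moreover have "finite U" using less.prems(1) assms(2) finite_subset by blast
    ultimately have card: "card (U \<union> {b, b'}) = 2 * (u + 1)" using b less.prems(2) by simp
    have rep: "\<exists>w\<in>ssum (u + 1) (U \<union> {b, b'}). q0 dvd z - w" if zT: "z \<in> T'" for z
    proof -
      obtain e where e: "e \<in> {b, b'}" "z - e \<in> T" using zT unfolding T'_def mem_translate Un_iff by blast
      then obtain w where w: "w \<in> ssum u U" "q0 dvd z - e - w" using less.prems(5) by blast
      have "w + e \<in> ssum (u + 1) (U \<union> {b, b'})"
        using b by (intro ssum_add[OF w(1) ssum_single[OF e(1)]]) auto
      moreover have "q0 dvd z - (w + e)" using w(2) by (simp add: algebra_simps)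
      ultimately show ?thesis by blast
    qed
    show ?thesis
      using less.hyps[OF lt(1) _ card lt(2) per(3) rep] less.prems(1) b by blast
  qed
qed

lemma pair_fill:
  assumes "q0 > 0" "finite B"
  obtains U u T where "U \<subseteq> B" "card U = 2 * u" "int u < q0" "T \<noteq> {}" "periodic q0 T"
    "\<And>z. z \<in> T \<Longrightarrow> \<exists>w\<in>ssum u U. q0 dvd z - w"
    "\<And>b b'. b \<in> B - U \<Longrightarrow> b' \<in> B - U \<Longrightarrow> periodic (b - b') T"
proof -
  let ?T = "periodize q0 {0}"
  have "0 \<in> ?T \<inter> {0..<q0}" using assms(1) by (simp add: periodize_def)
  then have "0 + 1 \<le> dens q0 ?T"
    unfolding dens_def by (metis Suc_eq_plus1 Suc_leI card_gt_0_iff empty_iff finite_Int finite_atLeastLessThan_int add_0)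
  moreover have "\<exists>w\<in>ssum 0 {}. q0 dvd z - w" if "z \<in> ?T" for z
    using that by (auto simp: periodize_def ssum_def)
  ultimately obtain U u T where 1: "U \<subseteq> B" "card U = 2 * u" "u + 1 \<le> dens q0 T" "periodic q0 T"
    "\<forall>z\<in>T. \<exists>w\<in>ssum u U. q0 dvd z - w" "\<forall>b\<in>B - U. \<forall>b'\<in>B - U. periodic (b - b') T"
    using pair_fill_step[OF assms, of "{}" 0 ?T] periodic_periodize[of q0 "{0}"] by auto
  have "dens q0 T \<le> nat q0" using dens_le assms(1) by simp
  then have "int u < q0" using 1(3) by linarith
  moreover have "T \<noteq> {}" using 1(3) by (auto simp: dens_def)
  ultimately show ?thesis using that[of U u T] 1 by blast
qed

text \<open>Pairs from \<open>B2\<close> fill a set \<open>T\<close> of residues modulo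
  \<open>q0\<close>, and the least period \<open>q\<close> of \<open>T\<close> replaces
  \<open>q0\<close> as the difference. The rest of \<open>B2\<close> lies in one class modulo
  \<open>q\<close>: this gives \<open>q * w <= l\<close>, and \<open>ap_extend\<close> then
  lengthens the progression.\<close>

lemma reduce_and_extend:
  assumes "B1 \<inter> B2 = {}" "finite B2" "B2 \<subseteq> {x..x + l}" "1 \<le> l" "q0 > 0"
    "ap a q0 (4 * l) \<subseteq> ssum k0 B1" "2 * P + w + 1 + 2 * nat q0 \<le> card B2"
  shows "\<exists>q k a'. 0 < q \<and> q * int w \<le> l \<and> k \<le> k0 + nat q0 + P \<and>
    ap a' q (int P * int w) \<subseteq> ssum k (B1 \<union> B2)"
proof -
  obtain U u T where U: "U \<subseteq> B2" "card U = 2 * u" "int u < q0" "T \<noteq> {}" "periodic q0 T"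
    "\<And>z. z \<in> T \<Longrightarrow> \<exists>w\<in>ssum u U. q0 dvd z - w"
    "\<And>b b'. b \<in> B2 - U \<Longrightarrow> b' \<in> B2 - U \<Longrightarrow> periodic (b - b') T"
    using pair_fill[OF assms(5,2)] by metis
  obtain q where q: "q > 0" "periodic q T" "\<And>p. periodic p T \<Longrightarrow> q dvd p"
    using minimal_period[OF U(5) assms(5)] by blast
  have "q dvd q0" using q(3) U(5) by blast
  then have qle: "q \<le> q0" using assms(5) by (simp add: zdvd_imp_le)
  obtain c where c: "c \<in> T" using U(4) by blast
  \<comment> \<open>No sum of \<open>u\<close> elements of \<open>U\<close> exceeds
    \<open>u * (x + l)\<close>, and \<open>a1\<close> is the first integer from \<open>A0\<close> on
    that is congruent to \<open>a + c\<close> modulo \<open>q\<close>; so \<open>z - w\<close> never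
    falls below \<open>a\<close>.\<close>
  define A0 where "A0 = a + int u * (x + l)"
  define a1 where "a1 = A0 + (a + c - A0) mod q"
  have a1: "A0 \<le> a1" "a1 < A0 + q" using q(1) by (simp_all add: a1_def)
  have a1c: "q dvd a1 - (a + c)"
  proof -
    have "a1 - (a + c) = - ((a + c - A0) - (a + c - A0) mod q)" by (simp add: a1_def)
    then show ?thesis using dvd_minus_mod[of q "a + c - A0"] by (simp only: dvd_minus_iff)
  qed
  have first: "ap a1 q l \<subseteq> ssum (k0 + u) (B1 \<union> U)"
  proof
    fix z assume "z \<in> ap a1 q l"
    then obtain i where i: "0 \<le> i" "i \<le> l" "z = a1 + q * i" by (auto simp: ap_def)
    have "q dvd (z - a) - c" using a1c dvd_add[of q "a1 - (a + c)" "q * i"] i by (simp add: algebra_simps)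
    then have "z - a \<in> T" using periodic_cong[OF q(2), of "z - a" c] c by blast
    then obtain w where w: "w \<in> ssum u U" "q0 dvd z - a - w" using U(6) by blast
    have wb: "int u * x \<le> w" "w \<le> int u * (x + l)"
      using ssum_bounds[OF w(1)] U(1) assms(3) by auto
    have "0 \<le> q * i" using i q by simp
    then have lo: "a \<le> z - w" using a1 wb i unfolding A0_def by linarith
    \<comment> \<open>Beyond \<open>a\<close>, the terms \<open>q * i\<close>, \<open>u * l\<close>
      and \<open>q\<close> are each at most \<open>q0 * l\<close>, so a progression of
      \<open>4 * l\<close> steps is long enough.\<close>
    have "q * i \<le> q0 * l" using i q(1) qle by (intro mult_mono) auto
    moreover have "int u * l \<le> q0 * l" using U(3) assms(4) by (intro mult_right_mono) auto
    moreover have "q0 \<le> q0 * l" using assms(4,5) by simp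
    moreover have "z \<le> a + int u * x + int u * l + q + q * i"
      using a1 i unfolding A0_def by (simp add: algebra_simps)
    moreover have "0 \<le> q0 * l" using assms(4,5) by simp
    ultimately have hi: "z - w \<le> a + q0 * (4 * l)"
      using wb qle by linarith
    have "q0 dvd z - w - a" using w(2) by (simp add: algebra_simps)
    then have "z - w \<in> ssum k0 B1" using mem_ap[OF assms(5) _ lo hi] assms(6) by blast
    from ssum_add[OF this w(1)] show "z \<in> ssum (k0 + u) (B1 \<union> U)" using assms(1) U(1) by auto
  qed
  define B3 where "B3 = B2 - U"
  have fin: "finite U" using U(1) assms(2) finite_subset by blast
  have c3: "2 * P + w + 1 \<le> card B3"
    using assms(7) U(1-3) fin unfolding B3_def by (simp add: card_Diff_subset)
  have cong: "q dvd b - b'" if "b \<in> B3" "b' \<in> B3" for b b'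
    using U(7) q(3) that unfolding B3_def by blast
  have B3: "finite B3" "B3 \<subseteq> {x..x + l}" "(B1 \<union> U) \<inter> B3 = {}" "B3 \<noteq> {}"
    using assms(1-3) c3 card.empty by (fastforce simp: B3_def)+
  have "l \<le> q * l" using q(1) assms(4) by simp
  then obtain a' where a': "ap a' q (l + int P * int w) \<subseteq> ssum (k0 + u + P) (B1 \<union> U \<union> B3)"
    using ap_extend[OF q(1) B3(1) cong B3(2) _ B3(3) first c3] by blast
  have "B1 \<union> U \<union> B3 = B1 \<union> B2" using U(1) by (auto simp: B3_def)
  then have "ap a' q (int P * int w) \<subseteq> ssum (k0 + u + P) (B1 \<union> B2)"
    using a' ap_mono[of "int P * int w" "l + int P * int w" a' q] assms(4) by auto
  moreover have "q * int w \<le> l"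
  proof -
    have "q * int w \<le> q * (int (card B3) - 1)" using q(1) c3 by (intro mult_left_mono) auto
    also have "\<dots> \<le> Max B3 - Min B3" by (rule card_residue_class_le[OF B3(1,4) q(1) cong])
    also have "\<dots> \<le> l" using window_diff[OF B3(2) Max_in[OF B3(1,4)] Min_in[OF B3(1,4)]] .
    finally show ?thesis .
  qed
  moreover have "k0 + u + P \<le> k0 + nat q0 + P" using U(3) by linarith
  ultimately show ?thesis using q(1) by blast
qed

section \<open>Progressions from popular sums\<close>

lemma sums_upto_bounds:
  assumes "\<And>j. D j \<subseteq> {y..y + w}"
  shows "z \<in> sums_upto D s \<Longrightarrow> int s * y \<le> z \<and> z \<le> int s * (y + w)"
proof (induction s arbitrary: z)
  case (Suc s)
  then obtain z' d where z: "z = z' + d" "z' \<in> sums_upto D s" "d \<in> D s" by (auto simp: sumset_def)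
  have "y \<le> d" "d \<le> y + w" using z(3) assms[of s] by auto
  then show ?case using Suc.IH[OF z(2)] z(1) by (auto simp: algebra_simps)
qed simp

text \<open>Taking \<open>v\<close> instead of \<open>u\<close> in \<open>i\<close> of the last
  \<open>n\<close> summands adds \<open>i * (v - u)\<close>.\<close>

lemma sums_upto_pairs:
  assumes "z \<in> sums_upto D s" "\<And>j. j < s + n \<Longrightarrow> u \<in> D j \<and> v \<in> D j" "i \<le> n"
  shows "z + int n * u + int i * (v - u) \<in> sums_upto D (s + n)"
  using assms(2-)
proof (induction n arbitrary: i)
  case 0
  then show ?case using assms(1) by simp
next
  case (Suc n)
  show ?case
  proof (cases "i \<le> n")
    case True
    then have "z + int n * u + int i * (v - u) \<in> sums_upto D (s + n)" using Suc by simp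
    moreover have "u \<in> D (s + n)" using Suc.prems(1) by simp
    moreover have "z + int (Suc n) * u + int i * (v - u) = (z + int n * u + int i * (v - u)) + u"
      by (simp add: algebra_simps)
    ultimately show ?thesis unfolding add_Suc_right sums_upto.simps sumset_def by blast
  next
    case False
    then have "i = Suc n" using Suc.prems by simp
    have "z + int n * u + int n * (v - u) \<in> sums_upto D (s + n)" using Suc by simp
    moreover have "v \<in> D (s + n)" using Suc.prems(1) by simp
    moreover have "z + int (Suc n) * u + int i * (v - u) = (z + int n * u + int n * (v - u)) + v"
      using \<open>i = Suc n\<close> by (simp add: algebra_simps)
    ultimately show ?thesis unfolding add_Suc_right sums_upto.simps sumset_def by blast
  qed
qed

text \<open>The first \<open>s\<close> terms are at least \<open>F s\<close> and the later ones at
  most \<open>F s\<close>, so the longer prefix has no larger average.\<close>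

lemma antimono_prefix_average:
  fixes F :: "nat \<Rightarrow> nat"
  assumes "antimono F" "s \<le> M"
  shows "s * (\<Sum>j<M. F j) \<le> M * (\<Sum>j<s. F j)"
proof -
  have split: "(\<Sum>j<M. F j) = (\<Sum>j<s. F j) + (\<Sum>j\<in>{s..<M}. F j)"
    using assms(2) by (metis atLeast0LessThan sum.atLeastLessThan_concat zero_le)
  have "(\<Sum>j\<in>{s..<M}. F j) \<le> (\<Sum>j\<in>{s..<M}. F s)"
    by (intro sum_mono antimonoD[OF assms(1)]) simp
  then have tail: "(\<Sum>j\<in>{s..<M}. F j) \<le> (M - s) * F s" by simp
  have "(\<Sum>j<s. F s) \<le> (\<Sum>j<s. F j)" by (intro sum_mono antimonoD[OF assms(1)]) simp
  then have head: "s * F s \<le> (\<Sum>j<s. F j)" by simp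
  have "s * (\<Sum>j\<in>{s..<M}. F j) \<le> s * ((M - s) * F s)" using tail by (rule mult_le_mono2)
  also have "\<dots> = (M - s) * (s * F s)" by simp
  also have "\<dots> \<le> (M - s) * (\<Sum>j<s. F j)" using head by (rule mult_le_mono2)
  finally have "s * (\<Sum>j<M. F j) \<le> s * (\<Sum>j<s. F j) + (M - s) * (\<Sum>j<s. F j)"
    unfolding split by (simp add: distrib_left)
  also have "\<dots> = M * (\<Sum>j<s. F j)" using assms(2) by (simp add: distrib_right[symmetric])
  finally show ?thesis .
qed

lemma antimono_sum_blocks:
  fixes F :: "nat \<Rightarrow> nat"
  assumes "antimono F"
  shows "(\<Sum>j<K * s. F j) \<le> K * (\<Sum>j<s. F j)"
proof (cases "K = 0 \<or> s = 0")
  case False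
  then have "s * (\<Sum>j<K * s. F j) \<le> K * s * (\<Sum>j<s. F j)"
    by (intro antimono_prefix_average[OF assms]) simp
  then show ?thesis using False by (simp add: mult.assoc mult.left_commute[of K s])
qed auto

text \<open>The case of a set not concentrated on a window of length \<open>l div 256\<close>. The
  first \<open>s\<close> summands fix a residue modulo \<open>g\<close>; the next \<open>n\<close>
  are \<open>u\<close> or \<open>v = u + g\<close> and supply the multiples of \<open>g\<close>. In
  total there are \<open>t = 1793 * s\<close> pairs, hence \<open>3586 * s\<close> elements.\<close>

lemma popular_ap:
  fixes l :: int and B :: "int set"
  defines "M \<equiv> card B"
  assumes B: "B \<subseteq> {x..x + l}" "1 \<le> l"
    and W: "\<And>z. card (B \<inter> {z..z + l div 256}) \<le> W"
    and big: "2^24 * nat l + 4 * (M * W) + M < M * M"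
  shows "\<exists>h s a. 0 < h \<and> h \<le> int s \<and> (s - 1) * (M - 1) \<le> 8208 * nat l \<and>
    ap a h (4 * l) \<subseteq> ssum (3586 * s) B"
proof -
  define L where "L = nat l"
  have L: "int L = l" "1 \<le> L" using B(2) by (auto simp: L_def)
  have finB: "finite B" using B(1) finite_subset by blast
  define F where "F j = card (popular B j)" for j
  have finP: "finite (popular B j)" for j using popular_range[OF B(1)] finite_subset by blast
  have anti: "antimono F" unfolding F_def using popular_antimono finP by (intro antimonoI card_mono)
  have Fle: "F j \<le> 3 * L" for j
  proof -
    have "F j \<le> card {2 * x..2 * x + 2 * l}"
      unfolding F_def using popular_range[OF B(1)] by (intro card_mono) auto
    then show ?thesis using L by simp
  qed
  have tot: "M * M \<le> 4 * (\<Sum>j<M. F j) + M" unfolding M_def F_def by (rule sum_card_popular[OF finB])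
  have big': "16777216 * L + 4 * (M * W) + M < M * M" using big by (simp add: L_def)
  have totL: "2052 * L \<le> (\<Sum>j<M. F j)" using tot big' by linarith
  \<comment> \<open>With at most 512 elements of each \<open>popular B j\<close> per residue modulo
    \<open>g\<close>, and with \<open>g <= 2 * L\<close>, this threshold makes the densities add up
    to at least \<open>2 * g\<close>. Minimality of \<open>s\<close> bounds it from above.\<close>
  define s where "s = (LEAST s. 2052 * L \<le> (\<Sum>j<s. F j))"
  have s1: "2052 * L \<le> (\<Sum>j<s. F j)" unfolding s_def using totL by (rule LeastI)
  have sM: "s \<le> M" unfolding s_def using totL by (rule Least_le)
  have s0: "s > 0" using s1 L by (cases s) auto
  have s2: "(\<Sum>j<s - 1. F j) < 2052 * L"
    using not_less_Least[of "s - 1" "\<lambda>s. 2052 * L \<le> (\<Sum>j<s. F j)"] s0 unfolding s_def[symmetric] by simp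
  have "(\<Sum>j<s. F j) = (\<Sum>j<s - 1. F j) + F (s - 1)"
    using s0 by (metis Suc_pred sum.lessThan_Suc One_nat_def)
  then have s3: "(\<Sum>j<s. F j) \<le> 2055 * L" using s2 Fle[of "s - 1"] by linarith
  have M0: "M > 0" using s0 sM by simp
  \<comment> \<open>The first \<open>s - 1\<close> sizes sum to less than \<open>2052 * L\<close>,
    while their average is at least the overall one, which is at least
    \<open>(M - 1) / 4\<close>.\<close>
  have sbound: "(s - 1) * (M - 1) \<le> 8208 * L"
  proof -
    have "(s - 1) * (\<Sum>j<M. F j) \<le> M * (\<Sum>j<s - 1. F j)"
      using sM by (intro antimono_prefix_average[OF anti]) simp
    also have "\<dots> \<le> M * (2052 * L)" using s2 by (intro mult_le_mono2) simp
    finally have 1: "(s - 1) * (4 * (\<Sum>j<M. F j)) \<le> M * (8208 * L)" by (simp add: mult_ac)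
    have "M * (M - 1) \<le> 4 * (\<Sum>j<M. F j)" using tot by (simp add: right_diff_distrib')
    then have "(s - 1) * (M * (M - 1)) \<le> (s - 1) * (4 * (\<Sum>j<M. F j))" by (rule mult_le_mono2)
    with 1 have "(s - 1) * (M * (M - 1)) \<le> M * (8208 * L)" by (rule order_trans[rotated])
    then have "M * ((s - 1) * (M - 1)) \<le> M * (8208 * L)" by (simp only: mult.left_commute)
    then show ?thesis using M0 by simp
  qed
  \<comment> \<open>The multiple of \<open>g\<close> to be supplied is at most
    \<open>7 * s * l\<close>, and \<open>l < 256 * g\<close>; hence
    \<open>1792 = 7 * 256\<close>.\<close>
  define n where "n = 1792 * s"
  define t where "t = s + n"
  have t: "t = 1793 * s" by (simp add: t_def n_def)
  \<comment> \<open>In such a window the sets from \<open>t\<close> on would contribute at most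
    \<open>M * W\<close>. The first \<open>t\<close> sets contribute at most
    \<open>1793 * 2055 * L\<close>, and \<open>4 * 1793 * 2055 < 2^24\<close> then contradicts
    \<open>big\<close>.\<close>
  have nowin: "\<not> popular B t \<subseteq> {y..y + l div 256}" for y
  proof
    assume "popular B t \<subseteq> {y..y + l div 256}"
    then have "(\<Sum>j\<in>{t..<M}. F j) \<le> M * W"
      unfolding F_def M_def by (rule sum_card_popular_window[OF finB _ W])
    moreover have "(\<Sum>j<t. F j) \<le> 1793 * (2055 * L)"
      using antimono_sum_blocks[OF anti, of 1793 s] s3 unfolding t by linarith
    moreover have "(\<Sum>j<M. F j) \<le> (\<Sum>j<t. F j) + (\<Sum>j\<in>{t..<M}. F j)"
    proof -
      have "(\<Sum>j<M. F j) \<le> (\<Sum>j\<in>{..<t} \<union> {t..<M}. F j)" by (intro sum_mono2) auto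
      also have "\<dots> = (\<Sum>j<t. F j) + (\<Sum>j\<in>{t..<M}. F j)" by (intro sum.union_disjoint) auto
      finally show ?thesis .
    qed
    ultimately show False using tot big' by linarith
  qed
  have ne: "popular B t \<noteq> {}" using nowin by auto
  define u v where "u = Min (popular B t)" and "v = Max (popular B t)"
  have uv: "u \<in> popular B t" "v \<in> popular B t" using ne finP by (auto simp: u_def v_def)
  define g where "g = v - u"
  have "popular B t \<subseteq> {u..v}" using finP by (auto simp: u_def v_def)
  then have "l div 256 < g" using nowin[of u] unfolding g_def
    by (metis add.commute atLeastatMost_subset_iff diff_le_eq linorder_not_le order_refl subset_trans)
  then have lg: "l < 256 * g" by linarith
  then have g0: "g > 0" using B(2) by simp
  have gl: "g \<le> 2 * l" unfolding g_def by (rule window_diff[OF popular_range[OF B(1)] uv(2,1)])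
  have fib: "F j \<le> 512 * dens g (periodize g (popular B j))" for j
  proof -
    have "g * (2 * l div g) < g * 512"
      using mult_div_mod_eq[of g "2 * l"] pos_mod_sign[OF g0, of "2 * l"] lg by linarith
    then have "2 * l div g \<le> 511" using g0 by simp
    have "int (F j) \<le> int (dens g (periodize g (popular B j))) * (2 * l div g + 1)"
      unfolding F_def using B(2) by (intro card_le_dens_periodize[OF g0 popular_range[OF B(1)]]) simp
    also have "\<dots> \<le> int (dens g (periodize g (popular B j))) * 512"
      using \<open>2 * l div g \<le> 511\<close> by (intro mult_left_mono) auto
    finally show ?thesis by linarith
  qed
  have "(\<Sum>j<s. F j) \<le> (\<Sum>j<s. 512 * dens g (periodize g (popular B j)))" by (intro sum_mono fib)
  then have "2052 * L \<le> 512 * (\<Sum>j<s. dens g (periodize g (popular B j)))"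
    using s1 by (simp add: sum_distrib_left)
  moreover have "nat g \<le> 2 * L" using gl L by linarith
  ultimately have cover: "2 * nat g \<le> (\<Sum>j<s. dens g (periodize g (popular B j)))" by linarith
  have "popular B j \<noteq> {}" if "j < s" for j
    using ne popular_antimono[of j t B] that by (auto simp: t_def)
  from sums_cover_residue_class[OF g0 this cover]
  obtain h c where h: "h > 0" "h \<le> int s" "h dvd g"
    "\<And>z. h dvd z - c \<Longrightarrow> \<exists>w\<in>sums_upto (popular B) s. g dvd z - w" by metis
  \<comment> \<open>\<open>A0\<close> bounds \<open>n * u\<close> plus any element of
    \<open>sums_upto (popular B) s\<close> from above, so from \<open>a\<close> on the multiple of
    \<open>g\<close> still missing is nonnegative.\<close>
  define A0 where "A0 = int n * u + int s * (2 * x + 2 * l)"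
  define a where "a = A0 + (int n * u + c - A0) mod h"
  have a: "A0 \<le> a" "a < A0 + h" using h(1) by (simp_all add: a_def)
  have ac: "h dvd a - (int n * u + c)"
  proof -
    have "a - (int n * u + c) = - ((int n * u + c - A0) - (int n * u + c - A0) mod h)" by (simp add: a_def)
    then show ?thesis using dvd_minus_mod[of h "int n * u + c - A0"] by (simp only: dvd_minus_iff)
  qed
  have "ap a h (4 * l) \<subseteq> ssum (3586 * s) B"
  proof
    fix z assume "z \<in> ap a h (4 * l)"
    then obtain i where i: "0 \<le> i" "i \<le> 4 * l" "z = a + h * i" by (auto simp: ap_def)
    have "h dvd (z - int n * u) - c"
      using ac dvd_add[of h "a - (int n * u + c)" "h * i"] i by (simp add: algebra_simps)
    then obtain w where w: "w \<in> sums_upto (popular B) s" "g dvd z - int n * u - w" using h(4) by blast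
    have wb: "int s * (2 * x) \<le> w" "w \<le> int s * (2 * x + 2 * l)"
      using sums_upto_bounds[OF popular_range[OF B(1)] w(1)] by auto
    obtain r where r: "z - int n * u - w = g * r" using w(2) by blast
    have "0 \<le> h * i" using h(1) i by simp
    then have "0 \<le> g * r" using r wb a i unfolding A0_def by linarith
    then have r0: "0 \<le> r" using g0 by (simp add: zero_le_mult_iff)
    have "h * i \<le> int s * (4 * l)" using h(1,2) i by (intro mult_mono) auto
    moreover have "h \<le> int s * l"
    proof -
      have "int s * 1 \<le> int s * l" using B(2) by (intro mult_left_mono) auto
      then show ?thesis using h(2) by simp
    qed
    moreover have "g * r \<le> h + h * i + int s * (2 * l)"
      using r wb(1) a(2) i unfolding A0_def by (simp add: algebra_simps)
    ultimately have "g * r \<le> 7 * (int s * l)" by (simp add: algebra_simps)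
    also have "\<dots> \<le> 7 * (int s * (256 * g))" using lg s0 by (intro mult_left_mono) auto
    also have "\<dots> = g * int n" by (simp add: n_def)
    finally have "r \<le> int n" using g0 by simp
    then have "nat r \<le> n" by simp
    have "u \<in> popular B j \<and> v \<in> popular B j" if "j < s + n" for j
      using uv popular_antimono[of j t B] that by (auto simp: t_def)
    from sums_upto_pairs[OF w(1) this \<open>nat r \<le> n\<close>]
    have "w + int n * u + r * g \<in> sums_upto (popular B) t" using r0 by (simp add: g_def t_def)
    moreover have "w + int n * u + r * g = z" using r by (simp add: algebra_simps)
    ultimately have "z \<in> ssum (2 * t) B" using sums_of_popular by simp
    then show "z \<in> ssum (3586 * s) B" by (simp add: t)
  qed
  then show ?thesis using h(1,2) sbound unfolding L_def by blast
qed

text \<open>\<open>IH\<close> is the induction hypothesis of \<open>long_ap\<close>. Either a window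
  of length \<open>l div 256\<close> holds at least \<open>m / 16\<close> elements of
  \<open>B1\<close> and \<open>IH\<close> applies to them, or \<open>popular_ap\<close> applies to
  \<open>B1\<close>. The constant for the difference is still weak; \<open>long_ap\<close> repairs
  it.\<close>

lemma long_ap_start:
  fixes l X :: int
  assumes IH: "\<And>l' X' y A. \<lbrakk>1 \<le> l'; l' < l; A \<subseteq> {y..y + l'}; 2048 * l' \<le> X';
      2^20 * X' \<le> (int (card A))\<^sup>2\<rbrakk> \<Longrightarrow>
      \<exists>q k a. 0 < q \<and> q * int (card A) \<le> 32 * l' \<and> int k * int (card A) \<le> 2^18 * X' \<and>
        ap a q X' \<subseteq> ssum k A"
    and B: "1 \<le> l" "B1 \<subseteq> {x..x + l}" "2048 * l \<le> X" "2^20 * X \<le> (int m)\<^sup>2"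
    and l: "256 \<le> l" and m: "2^15 \<le> m" "int m \<le> l + 1" and B1: "card B1 = m div 2"
  shows "\<exists>q k a. 0 < q \<and> q * int m \<le> 2^16 * l \<and> int k * int m \<le> 2^17 * X \<and>
    ap a q (4 * l) \<subseteq> ssum k B1"
proof -
  define M where "M = int m"
  have MX: "1048576 * X \<le> M * M" using B(4) by (simp add: M_def power2_eq_square)
  have Ml: "M \<le> l + 1" "32768 \<le> M" using m by (simp_all add: M_def)
  define l' where "l' = l div 256"
  have "l = 256 * l' + l mod 256" "0 \<le> l mod 256" "l mod 256 < 256" by (simp_all add: l'_def)
  moreover from this have "1 \<le> l'" using l by linarith
  ultimately have l': "1 \<le> l'" "256 * l' \<le> l" "l \<le> 512 * l'" "l' < l" using l by linarith+
  show ?thesis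
  proof (cases "\<exists>z. m \<le> 16 * card (B1 \<inter> {z..z + l'})")
    case True
    then obtain z where z: "m \<le> 16 * card (B1 \<inter> {z..z + l'})" by blast
    define A where "A = B1 \<inter> {z..z + l'}"
    define M' where "M' = int (card A)"
    have M': "M \<le> 16 * M'" "0 \<le> M'" using z by (simp_all add: M_def M'_def A_def)
    have "M * M \<le> (16 * M') * (16 * M')" using M' Ml by (intro mult_mono) auto
    \<comment> \<open>The length falls by a factor of at least \<open>256 = 16^2\<close> and the
      cardinality by at most 16, so the density hypothesis survives. As
      \<open>l <= 512 * l'\<close>, a progression of \<open>2048 * l'\<close> steps has the
      \<open>4 * l\<close> steps wanted.\<close>
    then have "2^20 * (2048 * l') \<le> M'\<^sup>2" using MX B(3) l' by (simp add: power2_eq_square)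
    then obtain q k a where q: "0 < q" "q * M' \<le> 32 * l'" "int k * M' \<le> 2^18 * (2048 * l')"
      "ap a q (2048 * l') \<subseteq> ssum k A"
      using IH[of l' A z "2048 * l'"] l' unfolding M'_def A_def by auto
    have "q * M \<le> 16 * (q * M')" using mult_left_mono[OF M'(1), of q] q(1) by (simp add: algebra_simps)
    then have 1: "q * M \<le> 2^16 * l" using q(2) l' by simp
    have "int k * M \<le> 16 * (int k * M')" using mult_left_mono[OF M'(1), of "int k"] by (simp add: algebra_simps)
    then have 2: "int k * M \<le> 2^17 * X" using q(3) l' B(3) by simp
    have "ap a q (4 * l) \<subseteq> ssum k B1"
      using q(4) ap_mono[of "4 * l" "2048 * l'" a q] ssum_mono[of A B1 k] l'(3) by (auto simp: A_def)
    then show ?thesis using q(1) 1 2 unfolding M_def by blast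
  next
    case False
    define W where "W = m div 16"
    have W: "card (B1 \<inter> {z..z + l div 256}) \<le> W" for z
      using False unfolding l'_def W_def by (metis div_le_mono linorder_not_le nat_less_le nonzero_mult_div_cancel_left zero_neq_numeral)
    define M1 where "M1 = int (card B1)"
    have M1: "M \<le> 2 * M1 + 1" "2 * M1 \<le> M" using B1 by (simp_all add: M1_def M_def)
    have W16: "16 * int W \<le> M" by (simp add: W_def M_def)
    have "M1 * (16 * int W) \<le> M1 * (2 * M1 + 1)"
      using W16 M1 Ml by (intro mult_left_mono) auto
    then have p1: "16 * (M1 * int W) \<le> 2 * (M1 * M1) + M1" by (simp add: algebra_simps)
    have "M * M \<le> (2 * M1 + 1) * (2 * M1 + 1)" using M1 Ml by (intro mult_mono) auto
    then have p2: "M * M \<le> 4 * (M1 * M1) + 4 * M1 + 1" by (simp add: algebra_simps)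
    have p3: "1000 * M1 \<le> M1 * M1" using M1 Ml by (intro mult_right_mono) auto
    have "16777216 * l + 4 * (M1 * int W) + M1 < M1 * M1"
      using p1 p2 p3 MX B(1,3) M1 Ml by linarith
    then have "int (2^24 * nat l + 4 * (card B1 * W) + card B1) < int (card B1 * card B1)"
      using B(1) by (simp add: M1_def)
    then have "2^24 * nat l + 4 * (card B1 * W) + card B1 < card B1 * card B1" by linarith
    then obtain h s a where h: "0 < h" "h \<le> int s" "(s - 1) * (card B1 - 1) \<le> 8208 * nat l"
      "ap a h (4 * l) \<subseteq> ssum (3586 * s) B1"
      using popular_ap[OF B(2,1) W] by blast
    have s0: "1 \<le> s" "1 \<le> card B1" using h M1 Ml by (linarith, simp add: M1_def)
    have "int ((s - 1) * (card B1 - 1)) \<le> int (8208 * nat l)" using h(3) by linarith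
    then have h3: "(int s - 1) * (M1 - 1) \<le> 8208 * l" using B(1) s0 by (simp add: M1_def of_nat_diff)
    have "(int s - 1) * M \<le> (int s - 1) * (4 * (M1 - 1))" using M1 Ml s0 by (intro mult_left_mono) auto
    then have "int s * M \<le> 4 * ((int s - 1) * (M1 - 1)) + M" by (simp add: algebra_simps)
    then have sM: "int s * M \<le> 32834 * l" using h3 Ml B(1) by linarith
    have "h * M \<le> int s * M" using h(2) Ml by (intro mult_right_mono) auto
    then have 1: "h * M \<le> 2^16 * l" using sM B(1) by simp
    have "3586 * (int s * M) \<le> 131072 * X" using sM B(1,3) by linarith
    moreover have "(2::int)^17 = 131072" by simp
    moreover have "int (3586 * s) * M = 3586 * (int s * M)" by simp
    ultimately have 2: "int (3586 * s) * M \<le> 2^17 * X" by (simp only:)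
    show ?thesis using h(1,4) 1 2 unfolding M_def by blast
  qed
qed

text \<open>Strong induction on the window length. One half of \<open>B\<close> gives a progression
  with the weak bound \<open>2^16 * l\<close> on \<open>q * card B\<close>; with the other half,
  \<open>reduce_and_extend\<close> brings the bound back to \<open>32 * l\<close>, so the constants
  do not deteriorate along the induction.\<close>

lemma long_ap:
  fixes l X :: int
  assumes "1 \<le> l" "B \<subseteq> {x..x + l}" "2048 * l \<le> X" "2^20 * X \<le> (int (card B))\<^sup>2"
  shows "\<exists>q k a. 0 < q \<and> q * int (card B) \<le> 32 * l \<and> int k * int (card B) \<le> 2^18 * X \<and>
    ap a q X \<subseteq> ssum k B"
  using assms
proof (induction "nat l" arbitrary: l X x B rule: less_induct)
  case less
  define m where "m = card B"
  define M where "M = int m"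
  note prems = less.prems
  have MX: "1048576 * X \<le> M * M" using prems(4) by (simp add: M_def m_def power2_eq_square)
  have fin: "finite B" using prems(2) finite_subset by blast
  have "m \<le> card {x..x + l}" unfolding m_def by (intro card_mono prems) simp
  then have Ml: "M \<le> l + 1" using prems(1) by (simp add: M_def)
  have M0: "0 \<le> M" by (simp add: M_def)
  \<comment> \<open>The induction has no base case: \<open>M <= l + 1\<close> and
    \<open>M * M >= 2^31 * l\<close> force \<open>l\<close> to be large, so that
    \<open>l div 256\<close> is positive.\<close>
  have "M * M \<le> (l + 1) * (l + 1)" using Ml M0 by (intro mult_mono) auto
  also have "\<dots> \<le> (2 * l) * (2 * l)" using prems(1) by (intro mult_mono) auto
  finally have "2147483648 * l \<le> (4 * l) * l" using MX prems(3) by linarith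
  then have l256: "256 \<le> l" using prems(1) by simp
  have M15: "32768 \<le> M"
  proof (rule ccontr)
    assume "\<not> 32768 \<le> M"
    then have "M * M \<le> 32768 * 32768" using M0 by (intro mult_mono) auto
    then show False using MX prems(1,3) by linarith
  qed
  obtain B1 where B1: "B1 \<subseteq> B" "card B1 = m div 2"
    using obtain_subset_with_card_n[of "m div 2" B] unfolding m_def by auto
  define B2 where "B2 = B - B1"
  have B2: "B1 \<inter> B2 = {}" "finite B2" "B2 \<subseteq> {x..x + l}" "B1 \<union> B2 = B" "card B2 = m - m div 2"
    using B1 fin prems(2) by (auto simp: B2_def card_Diff_subset finite_subset m_def)
  have "\<exists>q k a. 0 < q \<and> q * int m \<le> 2^16 * l \<and> int k * int m \<le> 2^17 * X \<and>
    ap a q (4 * l) \<subseteq> ssum k B1"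
  proof (rule long_ap_start)
    fix l' X' :: int and y A
    assume "1 \<le> l'" "l' < l" "A \<subseteq> {y..y + l'}" "2048 * l' \<le> X'" "2^20 * X' \<le> (int (card A))\<^sup>2"
    then show "\<exists>q k a. 0 < q \<and> q * int (card A) \<le> 32 * l' \<and> int k * int (card A) \<le> 2^18 * X' \<and>
        ap a q X' \<subseteq> ssum k A" using less.hyps[of l' A y X'] by simp
  qed (use prems B1 l256 M15 Ml in \<open>auto simp: m_def M_def\<close>)
  then obtain q0 k0 a0 where q0: "0 < q0" "q0 * M \<le> 65536 * l" "int k0 * M \<le> 131072 * X"
    "ap a0 q0 (4 * l) \<subseteq> ssum k0 B1" unfolding M_def by auto
  define w where "w = m div 16"
  have w: "16 * int w \<le> M" "M \<le> 32 * int w" "0 < int w"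
    using M15 unfolding w_def M_def by linarith+
  \<comment> \<open>Each of \<open>p\<close> pairs lengthens the progression by \<open>w\<close>
    steps, so this \<open>p\<close> makes it reach \<open>X\<close>.\<close>
  define p where "p = X div int w + 1"
  have X0: "0 \<le> X" using prems by simp
  have p0: "1 \<le> p" using X0 w(3) by (simp add: p_def pos_imp_zdiv_nonneg_iff)
  have "p * int w = int w * (X div int w) + int w" by (simp add: p_def algebra_simps)
  then have wX: "X \<le> p * int w" "p * int w \<le> X + int w"
    using mult_div_mod_eq[of "int w" X] pos_mod_sign[OF w(3), of X] pos_mod_bound[OF w(3), of X]
    by linarith+
  have "p * M \<le> p * (32 * int w)" using w p0 by (intro mult_left_mono) auto
  then have pM: "p * M \<le> 34 * X" using wX w Ml prems(1,3) by linarith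
  \<comment> \<open>Since \<open>M * M >= 2^20 * X\<close>, both \<open>p\<close> and
    \<open>q0\<close> are tiny fractions of \<open>M\<close>; with \<open>w <= M / 16\<close>,
    everything fits into the at least \<open>M / 2\<close> elements of \<open>B2\<close>.\<close>
  have small: "1048576 * y \<le> 34 * M" if "y * M \<le> 34 * X" for y
  proof -
    have "(1048576 * y) * M \<le> (34 * M) * M" using that MX unfolding mult.assoc by linarith
    then show ?thesis using M15 by simp
  qed
  have ps: "1048576 * p \<le> 34 * M" using small[OF pM] .
  have qs: "1048576 * q0 \<le> 34 * M" using q0(2) prems(1,3) by (intro small) simp
  have "2 * p + int w + 1 + 2 * q0 \<le> int (card B2)"
    using ps qs w(1) M15 B2(5) unfolding M_def by linarith
  then have "2 * nat p + w + 1 + 2 * nat q0 \<le> card B2" using p0 q0(1) by linarith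
  from reduce_and_extend[OF B2(1-3) prems(1) q0(1,4) this]
  obtain q k a where q: "0 < q" "q * int w \<le> l" "k \<le> k0 + nat q0 + nat p"
    "ap a q (int (nat p) * int w) \<subseteq> ssum k B" unfolding B2(4) by blast
  have "q * M \<le> q * (32 * int w)" using w q(1) by (intro mult_left_mono) auto
  then have 1: "q * M \<le> 32 * l" using q(2) by simp
  have "int k * M \<le> (int k0 + q0 + p) * M" using q(3) q0(1) p0 M0 by (intro mult_right_mono) auto
  also have "\<dots> = int k0 * M + q0 * M + p * M" by (simp add: algebra_simps)
  also have "\<dots> \<le> 2^18 * X" using q0(2,3) pM prems(1,3) by simp
  finally have 2: "int k * M \<le> 2^18 * X" .
  have "ap a q X \<subseteq> ssum k B"
    using q(4) ap_mono[of X "int (nat p) * int w" a q] wX(1) p0 by auto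
  then show ?case using q(1) 1 2 unfolding M_def m_def by blast
qed

section \<open>Subset sums in all residue classes\<close>

definition subsums :: "int set \<Rightarrow> int set" where
  "subsums U = {\<Sum>S | S. S \<subseteq> U}"

lemma subsums_insert:
  assumes "finite U" "a \<notin> U"
  shows "subsums (insert a U) = subsums U \<union> translate a (subsums U)"
proof (rule set_eqI)
  fix z
  have "z \<in> subsums (insert a U) \<longleftrightarrow> z \<in> sum id ` Pow (insert a U)" by (auto simp: subsums_def)
  also have "\<dots> \<longleftrightarrow> z \<in> sum id ` Pow U \<or> z \<in> sum id ` insert a ` Pow U"
    by (simp add: Pow_insert image_Un)
  also have "z \<in> sum id ` insert a ` Pow U \<longleftrightarrow> (\<exists>S\<subseteq>U. z = a + \<Sum>S)"
  proof -
    have "sum id (insert a S) = a + \<Sum>S" if "S \<subseteq> U" for S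
      using that assms finite_subset[OF that] by (subst sum.insert) auto
    then show ?thesis by (auto simp: image_iff)
  qed
  also have "\<dots> \<longleftrightarrow> z \<in> translate a (subsums U)"
    by (auto simp: mem_translate subsums_def algebra_simps)
  finally show "z \<in> subsums (insert a U) \<longleftrightarrow> z \<in> subsums U \<union> translate a (subsums U)"
    by (auto simp: subsums_def)
qed

lemma periodize_Un: "periodize q (S \<union> T) = periodize q S \<union> periodize q T"
  unfolding periodize_def by blast

lemma periodize_translate: "periodize q (translate a T) = translate a (periodize q T)"
proof (rule set_eqI)
  fix z
  have "(\<exists>t. t - a \<in> T \<and> q dvd z - t) \<longleftrightarrow> (\<exists>t\<in>T. q dvd z - a - t)"
    by (metis add.commute add_diff_cancel_right' diff_add_cancel diff_diff_eq)
  then show "z \<in> periodize q (translate a T) \<longleftrightarrow> z \<in> translate a (periodize q T)"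
    by (simp add: periodize_def translate_def Bex_def)
qed

lemma periodize_subsums_insert:
  assumes "finite U" "a \<notin> U"
  shows "periodize q (subsums (insert a U)) =
    periodize q (subsums U) \<union> translate a (periodize q (subsums U))"
  by (simp add: subsums_insert[OF assms] periodize_Un periodize_translate)

lemma dens_periodize_pos: "q > 0 \<Longrightarrow> 0 < dens q (periodize q (subsums {}))"
  unfolding dens_def by (subst card_gt_0_iff) (auto simp: subsums_def periodize_def)

text \<open>Go through \<open>R\<close> and keep an element only if it adds a residue to the subset
  sums modulo \<open>q\<close>. Each kept element raises the density by at least 1, so fewer than
  \<open>q\<close> are kept.\<close>

lemma subsums_select:
  assumes "finite R" "q > 0"
  shows "\<exists>U\<subseteq>R. periodize q (subsums U) = periodize q (subsums R) \<and>
    card U + 1 \<le> dens q (periodize q (subsums U))"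
  using assms(1)
proof (induction R rule: finite_induct)
  case empty
  then show ?case using dens_periodize_pos[OF assms(2)] by simp
next
  case (insert a R)
  then obtain U where U: "U \<subseteq> R" "periodize q (subsums U) = periodize q (subsums R)"
    "card U + 1 \<le> dens q (periodize q (subsums U))" by blast
  let ?T = "periodize q (subsums R)"
  have aU: "finite U" "a \<notin> U" using U(1) insert finite_subset by auto
  have R: "periodize q (subsums (insert a R)) = ?T \<union> translate a ?T"
    using insert by (intro periodize_subsums_insert)
  show ?case
  proof (cases "translate a ?T \<subseteq> ?T")
    case True
    then have "?T \<union> translate a ?T = ?T" by blast
    then show ?thesis using R U by (intro exI[of _ U]) auto
  next
    case False
    then obtain z where z: "z \<in> translate a ?T" "z \<notin> ?T" by blast
    have eq: "periodize q (subsums (insert a U)) = ?T \<union> translate a ?T"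
      using periodize_subsums_insert[OF aU, of q] U(2) by simp
    have "dens q ?T < dens q (?T \<union> translate a ?T)"
      by (rule dens_psubset[OF _ _ assms(2) _ _ z(2)])
         (use z in \<open>auto intro: periodic_periodize periodic_Un periodic_translate\<close>)
    then have "card (insert a U) + 1 \<le> dens q (?T \<union> translate a ?T)" using U(2,3) aU by simp
    then show ?thesis using R eq U(1) by (intro exI[of _ "insert a U"]) auto
  qed
qed

text \<open>Periods persist when elements are added, so as long as the final set of residues has
  trivial stabiliser every element not divisible by \<open>h\<close> makes the set grow.\<close>
lemma subsums_growth:
  assumes "finite U" "h > 0"
    "\<And>p. periodic p (periodize h (subsums U)) \<Longrightarrow> h dvd p"
  shows "card {a \<in> U. \<not> h dvd a} + 1 \<le> dens h (periodize h (subsums U))"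
  using assms(1,3)
proof (induction U rule: finite_induct)
  case empty
  then show ?case using dens_periodize_pos[OF assms(2)] by simp
next
  case (insert a U)
  define T where "T = periodize h (subsums U)"
  define T' where "T' = T \<union> translate a T"
  have T': "periodize h (subsums (insert a U)) = T'"
    unfolding T_def T'_def using insert.hyps by (intro periodize_subsums_insert)
  have perT: "periodic h T" "periodic h (translate a T)" "periodic h T'"
    unfolding T'_def T_def by (intro periodic_Un periodic_translate periodic_periodize)+
  have "periodic p T'" if "periodic p T" for p
    unfolding T'_def using that by (intro periodic_Un periodic_translate)
  then have min: "h dvd p" if "periodic p T" for p using insert.prems that T' by simp
  have IH: "card {a \<in> U. \<not> h dvd a} + 1 \<le> dens h T"
    using insert.IH min unfolding T_def by blast
  show ?case
  proof (cases "h dvd a")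
    case True
    then have "{x \<in> insert a U. \<not> h dvd x} = {x \<in> U. \<not> h dvd x}" by auto
    moreover have "dens h T \<le> dens h T'" by (rule dens_mono) (auto simp: T'_def)
    ultimately show ?thesis unfolding T' using IH by simp
  next
    case False
    then have "\<not> periodic a T" using min by blast
    then obtain z where z: "(z + a \<in> T) \<noteq> (z \<in> T)" unfolding periodic_def by blast
    have "dens h T < dens h T'"
    proof (cases "z \<in> T")
      case True
      then have "z + a \<in> T'" "z + a \<notin> T" using z by (auto simp: T'_def mem_translate)
      then show ?thesis using dens_psubset[OF perT(1,3) assms(2)] by (auto simp: T'_def)
    next
      case False
      then have "z + a \<in> T'" "z + a \<notin> translate a T" using z by (auto simp: T'_def mem_translate)
      then have "dens h (translate a T) < dens h T'"
        using dens_psubset[OF perT(2,3) assms(2)] by (auto simp: T'_def)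
      then show ?thesis using dens_translate[OF perT(1) assms(2)] by simp
    qed
    moreover have "{x \<in> insert a U. \<not> h dvd x} = insert a {x \<in> U. \<not> h dvd x}" using False by auto
    then have "card {x \<in> insert a U. \<not> h dvd x} = card {x \<in> U. \<not> h dvd x} + 1"
      using insert.hyps by simp
    ultimately show ?thesis unfolding T' using IH by simp
  qed
qed

text \<open>Let \<open>h\<close> be the least period of the subset sums of \<open>R\<close> modulo
  \<open>q\<close>. If \<open>h > 1\<close>, at least \<open>h\<close> elements are not divisible by
  \<open>h\<close>, and \<open>subsums_growth\<close> yields more than \<open>h\<close> residues
  modulo \<open>h\<close>. So \<open>h = 1\<close> and every residue occurs;
  \<open>subsums_select\<close> supplies the small \<open>U\<close>.\<close>

lemma subsums_cover_residues:
  assumes "finite R" "q > 0"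
    "\<And>e. e dvd q \<Longrightarrow> 1 < e \<Longrightarrow> e \<le> int (card {a \<in> R. \<not> e dvd a})"
  obtains U where "U \<subseteq> R" "int (card U) < q" "\<And>z. \<exists>w\<in>subsums U. q dvd z - w"
proof -
  define T where "T = periodize q (subsums R)"
  have perT: "periodic q T" unfolding T_def by (rule periodic_periodize)
  obtain U where U: "U \<subseteq> R" "periodize q (subsums U) = T" "card U + 1 \<le> dens q T"
    using subsums_select[OF assms(1,2)] unfolding T_def by metis
  have "dens q T \<le> nat q" using assms(2) by (intro dens_le) simp
  then have cU: "int (card U) < q" using U(3) by linarith
  obtain h where h: "h > 0" "periodic h T" "\<And>p. periodic p T \<Longrightarrow> h dvd p"
    using minimal_period[OF perT assms(2)] by blast
  have hq: "h dvd q" using h(3) perT by blast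
  have "subsums R \<subseteq> T" unfolding T_def by (rule periodize_superset)
  then have "periodize h (subsums R) \<subseteq> T"
    using periodic_cong[OF h(2)] unfolding periodize_def by blast
  then have eq: "periodize h (subsums R) = T"
    using periodize_mono_dvd[OF hq, of "subsums R"] unfolding T_def by blast
  then have "card {a \<in> R. \<not> h dvd a} + 1 \<le> dens h T"
    using subsums_growth[OF assms(1) h(1)] h(3) by simp
  moreover have "dens h T \<le> nat h" using h(1) by (intro dens_le) simp
  ultimately have "int (card {a \<in> R. \<not> h dvd a}) < h" by linarith
  then have "h = 1" using assms(3)[OF hq] h(1) by linarith
  have "0 \<in> subsums R" unfolding subsums_def by (intro CollectI exI[of _ "{}"]) simp
  then have "0 \<in> T" using \<open>subsums R \<subseteq> T\<close> by blast
  then have "z \<in> T" for z using periodic_cong[OF h(2), of z 0] \<open>h = 1\<close> by simp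
  then have "\<exists>w\<in>subsums U. q dvd z - w" for z using U(2) unfolding periodize_def by blast
  then show ?thesis using that U(1) cU by blast
qed

section \<open>Random subsets with large intersections\<close>

lemma sum_Pow_half_power:
  assumes "finite A" "E \<subseteq> A"
  shows "(\<Sum>R\<in>Pow A. (1/2::real) ^ card (R \<inter> E)) = 2 ^ card A * (3/4) ^ card E"
proof -
  let ?f = "\<lambda>x. if x \<in> E then 1/2 else (1::real)"
  have finE: "finite E" using assms finite_subset by blast
  have pr: "(\<Prod>x\<in>R. if x \<in> E then c else (d::real)) = c ^ card (R \<inter> E) * d ^ card (R - E)"
    if "R \<subseteq> A" for R c d
    using finite_subset[OF that assms(1)]
    by (simp add: prod.If_cases Int_def[symmetric] Diff_eq[symmetric] Collect_neg_eq[symmetric]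
        set_diff_eq[symmetric])
  have "(\<Sum>R\<in>Pow A. (1/2::real) ^ card (R \<inter> E)) = (\<Sum>R\<in>Pow A. prod ?f R * prod (\<lambda>_. 1) (A - R))"
    using pr[of _ "1/2" 1] by (intro sum.cong refl) auto
  \<comment> \<open>The sum over all subsets is an expanded product: an element of \<open>E\<close>
    contributes \<open>1/2 + 1\<close>, any other \<open>1 + 1\<close>.\<close>
  also have "\<dots> = (\<Prod>x\<in>A. ?f x + 1)" using assms(1) by (rule prod_add[symmetric])
  also have "\<dots> = (\<Prod>x\<in>A. if x \<in> E then 3/2 else 2)" by (intro prod.cong) auto
  also have "\<dots> = (3/2) ^ card E * 2 ^ card (A - E)"
    using pr[of A "3/2" 2] assms(2) by (simp add: Int_absorb1)
  also have "\<dots> = 2 ^ card A * (3/4) ^ card E"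
  proof -
    have "card A = card E + card (A - E)"
      using assms finE card_Diff_subset[of E A] card_mono[of A E] by simp
    then have "2 ^ card A * (3/4::real) ^ card E = 2 ^ card (A - E) * (2 ^ card E * (3/4) ^ card E)"
      by (simp add: power_add)
    also have "2 ^ card E * (3/4::real) ^ card E = (3/2) ^ card E"
      by (simp add: power_mult_distrib[symmetric])
    finally show ?thesis by simp
  qed
  finally show ?thesis .
qed

text \<open>Markov's inequality for \<open>(1/2) ^ card (R \<inter> E)\<close>, which has mean
  \<open>(3/4) ^ card E\<close> for a uniformly random \<open>R\<close>. As
  \<open>(3/4)^16 <= 1/8\<close>, dividing by \<open>(1/2)^j\<close> leaves
  \<open>(1/4)^j\<close>.\<close>

lemma card_small_intersection:
  assumes "finite A" "E \<subseteq> A" "16 * j \<le> card E"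
  shows "real (card {R \<in> Pow A. card (R \<inter> E) \<le> j}) \<le> 2 ^ card A * (1/4) ^ j"
proof -
  let ?Z = "{R \<in> Pow A. card (R \<inter> E) \<le> j}"
  have "real (card ?Z) * (1/2) ^ j = (\<Sum>R\<in>?Z. (1/2::real) ^ j)" by simp
  also have "\<dots> \<le> (\<Sum>R\<in>?Z. (1/2::real) ^ card (R \<inter> E))"
    by (intro sum_mono power_decreasing) auto
  also have "\<dots> \<le> (\<Sum>R\<in>Pow A. (1/2::real) ^ card (R \<inter> E))"
    using assms(1) by (intro sum_mono2) auto
  also have "\<dots> = 2 ^ card A * (3/4) ^ card E" by (rule sum_Pow_half_power[OF assms(1,2)])
  also have "\<dots> \<le> 2 ^ card A * (3/4) ^ (16 * j)"
    using assms(3) by (intro mult_left_mono power_decreasing) auto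
  also have "\<dots> \<le> 2 ^ card A * (1/8) ^ j"
  proof -
    have "(3/4::real) ^ 16 \<le> 1/8" by (simp add: field_simps)
    then have "((3/4::real) ^ 16) ^ j \<le> (1/8) ^ j" by (intro power_mono) auto
    then show ?thesis by (simp add: power_mult)
  qed
  also have "(1/8::real) ^ j = (1/4) ^ j * (1/2) ^ j" by (simp add: power_mult_distrib[symmetric])
  finally have "real (card ?Z) * (1/2) ^ j \<le> (2 ^ card A * (1/4) ^ j) * (1/2) ^ j" by (simp add: mult.assoc)
  then show ?thesis by simp
qed

lemma sum_quarter_powers: "(\<Sum>i<n. (1/4::real) ^ (i + 2)) \<le> 1/4 - (1/4) ^ (n + 1)"
proof (induction n)
  case (Suc n)
  have "(0::real) \<le> (1/4) ^ n" by simp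
  moreover have "(1/4::real) ^ (n + 2) = (1/4) ^ n / 16" "(1/4::real) ^ (Suc n + 1) = (1/4) ^ n / 16"
    "(1/4::real) ^ (n + 1) = (1/4) ^ n / 4" by simp_all
  ultimately show ?case using Suc unfolding sum.lessThan_Suc by linarith
qed simp

text \<open>A uniformly random subset \<open>R\<close> fails with small probability: the failure
  probabilities decay geometrically in \<open>e\<close>, so no logarithmic factor is lost.\<close>
lemma split_set:
  fixes A :: "int set" and E :: "nat \<Rightarrow> int set"
  assumes "finite A" "16 \<le> card A"
    "\<And>e. 2 \<le> e \<Longrightarrow> e \<le> Q \<Longrightarrow> E e \<subseteq> A \<and> 16 * e \<le> card (E e)"
  obtains R where "R \<subseteq> A" "card A \<le> 16 * card (A - R)"
    "\<And>e. 2 \<le> e \<Longrightarrow> e \<le> Q \<Longrightarrow> e \<le> card (R \<inter> E e)"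
proof -
  define N where "N = card A"
  define n where "n = Q - 1"
  \<comment> \<open>The bad events: \<open>Z i\<close> belongs to the modulus \<open>i + 2\<close>,
    and \<open>Y\<close> to a remainder \<open>A - R\<close> that is too small. Under
    complementation \<open>Y\<close> becomes an event of the same kind, with \<open>A\<close> in
    place of \<open>E\<close>.\<close>
  define Z where "Z i = {R \<in> Pow A. card (R \<inter> E (i + 2)) \<le> i + 2}" for i
  define Y where "Y = {R \<in> Pow A. card (A - R) \<le> N div 16}"
  have "Y = (\<lambda>R. A - R) ` {R \<in> Pow A. card (R \<inter> A) \<le> N div 16}"
  proof (rule set_eqI)
    fix R
    have "R \<in> Y \<Longrightarrow> R = A - (A - R) \<and> A - R \<in> {R \<in> Pow A. card (R \<inter> A) \<le> N div 16}"
      by (auto simp: Y_def Int_absorb2 double_diff)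
    moreover have "A - R \<in> Y" if "R \<in> {R \<in> Pow A. card (R \<inter> A) \<le> N div 16}" for R
      using that by (auto simp: Y_def double_diff Int_absorb2)
    ultimately show "R \<in> Y \<longleftrightarrow> R \<in> (\<lambda>R. A - R) ` {R \<in> Pow A. card (R \<inter> A) \<le> N div 16}" by blast
  qed
  then have "card Y \<le> card {R \<in> Pow A. card (R \<inter> A) \<le> N div 16}"
    using assms(1) by (simp add: card_image_le)
  then have "real (card Y) \<le> 2 ^ N * (1/4) ^ (N div 16)"
    using card_small_intersection[OF assms(1) order_refl, of "N div 16"] by (simp add: N_def)
  also have "\<dots> \<le> 2 ^ N * (1/4) ^ 1"
    using assms(2) unfolding N_def by (intro mult_left_mono power_decreasing) auto
  finally have Y: "real (card Y) \<le> 2 ^ N * (1/4)" by simp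
  have Zi: "real (card (Z i)) \<le> 2 ^ N * (1/4) ^ (i + 2)" if "i < n" for i
    unfolding Z_def N_def using assms(3)[of "i + 2"] that
    by (intro card_small_intersection[OF assms(1)]) (auto simp: n_def)
  have fin: "finite Y" "finite (Z i)" for i using assms(1) by (auto simp: Y_def Z_def)
  have "real (card (Y \<union> (\<Union>i<n. Z i))) \<le> real (card Y) + (\<Sum>i<n. real (card (Z i)))"
    using card_Un_le[of Y "\<Union>i<n. Z i"] card_UN_le[of "{..<n}" Z]
    by (simp flip: of_nat_sum of_nat_add)
  also have "\<dots> \<le> 2 ^ N * (1/4) + (\<Sum>i<n. 2 ^ N * (1/4) ^ (i + 2))"
    by (intro add_mono sum_mono Y Zi) auto
  also have "\<dots> = 2 ^ N * (1/4 + (\<Sum>i<n. (1/4) ^ (i + 2)))"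
    by (simp only: sum_distrib_left distrib_left)
  also have "\<dots> \<le> 2 ^ N * (1/2)"
  proof (rule mult_left_mono)
    have "(0::real) \<le> (1/4) ^ (n + 1)" by simp
    then show "1/4 + (\<Sum>i<n. (1/4) ^ (i + 2)) \<le> (1/2::real)" using sum_quarter_powers[of n] by linarith
  qed simp
  also have "\<dots> < 2 ^ N" by simp
  also have "\<dots> = real (card (Pow A))" using assms(1) by (simp add: card_Pow N_def)
  finally have "card (Y \<union> (\<Union>i<n. Z i)) < card (Pow A)" by simp
  then have "\<not> Pow A \<subseteq> Y \<union> (\<Union>i<n. Z i)"
    using card_mono[of "Y \<union> (\<Union>i<n. Z i)" "Pow A"] fin by auto
  then obtain R where R: "R \<subseteq> A" "R \<notin> Y" "\<And>i. i < n \<Longrightarrow> R \<notin> Z i" by auto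
  have "e \<le> card (R \<inter> E e)" if "2 \<le> e" "e \<le> Q" for e
  proof -
    have "e - 2 < n" "e - 2 + 2 = e" using that by (auto simp: n_def)
    then show ?thesis using R(3)[of "e - 2"] R(1) by (simp add: Z_def del: add_2_eq_Suc')
  qed
  moreover have "card A \<le> 16 * card (A - R)"
    using R(1,2) by (auto simp: Y_def N_def)
  ultimately show ?thesis using that R(1) by blast
qed

section \<open>Intervals in subset sums\<close>

lemma subsums_bounds:
  assumes "w \<in> subsums U" "U \<subseteq> {1..N}" "int (card U) \<le> q" "0 \<le> N"
  shows "0 \<le> w \<and> w \<le> q * N"
proof -
  obtain V where V: "w = \<Sum>V" "V \<subseteq> U" using assms(1) by (auto simp: subsums_def)
  have finU: "finite U" using assms(2) finite_subset by blast
  have "0 \<le> \<Sum>V" using V(2) assms(2) by (intro sum_nonneg) fastforce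
  moreover have "\<Sum>V \<le> int (card V) * N" using V(2) assms(2) by (intro sum_bounded_above) auto
  moreover have "int (card V) * N \<le> q * N"
    using card_mono[OF finU V(2)] assms(3,4) by (intro mult_right_mono) auto
  ultimately show ?thesis using V(1) by simp
qed

text \<open>Subtract from \<open>z\<close> a subset sum \<open>w\<close> of the small set
  \<open>U\<close> with the residue of \<open>z - a\<close> modulo \<open>q\<close>; then
  \<open>z - w\<close> is a term of the progression. As \<open>0 <= w <= q * N\<close>, the interval
  starts at \<open>a + q * N\<close> and the progression is longer by \<open>q * N\<close>.\<close>

lemma interval_in_subset_sums:
  assumes "R \<inter> B = {}" "R \<union> B = A" "A \<subseteq> {1..N}" "0 \<le> N" "0 < q"
    "ap a q X \<subseteq> ssum k B" "q * N + n \<le> q * X"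
    "\<And>e. e dvd q \<Longrightarrow> 1 < e \<Longrightarrow> e \<le> int (card {x \<in> R. \<not> e dvd x})"
    "real k + real_of_int q \<le> h"
  shows "\<exists>b. {b..<b + n} \<subseteq> subset_sums_le h A"
proof -
  have finR: "finite R" using assms(2,3) by (metis finite_atLeastAtMost_int finite_Un finite_subset)
  obtain U where U: "U \<subseteq> R" "int (card U) < q" "\<And>z. \<exists>w\<in>subsums U. q dvd z - w"
    using subsums_cover_residues[OF finR assms(5,8)] by blast
  have UN: "U \<subseteq> {1..N}" using U(1) assms(2,3) by blast
  have finU: "finite U" using U(1) finR finite_subset by blast
  have "{a + q * N..<a + q * N + n} \<subseteq> subset_sums_le h A"
  proof
    fix z assume z: "z \<in> {a + q * N..<a + q * N + n}"
    obtain w where w: "w \<in> subsums U" "q dvd (z - a) - w" using U(3) by blast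
    have wb: "0 \<le> w" "w \<le> q * N" using subsums_bounds[OF w(1) UN _ assms(4), of q] U(2) by auto
    have "q dvd (z - w) - a" using w(2) by (simp add: algebra_simps)
    moreover have "a \<le> z - w" "z - w \<le> a + q * X" using z wb assms(7) by auto
    ultimately have "z - w \<in> ssum k B" using mem_ap[OF assms(5)] assms(6) by blast
    then obtain S where S: "z - w = \<Sum>S" "S \<subseteq> B" "finite S" "card S = k" by (auto simp: ssum_def)
    obtain V where V: "w = \<Sum>V" "V \<subseteq> U" using w(1) by (auto simp: subsums_def)
    have finV: "finite V" "card V \<le> card U" using V(2) finU finite_subset card_mono by auto
    have disj: "S \<inter> V = {}" using S(2) V(2) U(1) assms(1) by blast
    have "z = \<Sum>(S \<union> V)" using S(1,3) V(1) finV disj by (simp add: sum.union_disjoint)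
    moreover have "S \<union> V \<subseteq> A" using S(2) V(2) U(1) assms(2) by blast
    moreover have "real (card (S \<union> V)) \<le> h"
    proof -
      have "card (S \<union> V) \<le> k + card U" using S(3,4) finV card_Un_le[of S V] by simp
      then have "real (card (S \<union> V)) \<le> real k + real (card U)" by linarith
      moreover have "real (card U) \<le> real_of_int q" using U(2) by linarith
      ultimately show ?thesis using assms(9) by linarith
    qed
    ultimately show "z \<in> subset_sums_le h A"
      unfolding subset_sums_le_def using S(3) finV(1) by blast
  qed
  then show ?thesis by blast
qed

text \<open>The elements removed number at most \<open>64 * d\<close>, and
  \<open>d * card A <= 2 * n\<close> turns this into a bound of order \<open>n / card A\<close>,
  without a logarithm.\<close>

lemma subset_sums_main:
  fixes n :: nat and A :: "int set"
  assumes A: "A \<subseteq> {1..int n}" and n: "1 \<le> n" and big: "2^60 * n \<le> (card A)\<^sup>2"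
  shows "\<exists>d::int. d \<ge> 1 \<and>
    (\<exists>a::int. {a..<a + int n} \<subseteq> subset_sums_le (2^50 * real n / real (card A)) (div_part d A)) \<and>
    real (card A) - real (card (div_part d A)) \<le> 2^30 * real n / real (card A)"
proof -
  define m where "m = int (card A)"
  define n' where "n' = int n"
  have fin: "finite A" using A finite_subset by blast
  have n1: "1 \<le> n'" using n by (simp add: n'_def)
  have "int (2^60 * n) \<le> int ((card A)\<^sup>2)" using big by linarith
  then have mn: "1152921504606846976 * n' \<le> m * m" by (simp add: m_def n'_def power2_eq_square)
  have m0: "0 \<le> m" by (simp add: m_def)
  have m20: "1048576 \<le> m"
  proof (rule ccontr)
    assume "\<not> 1048576 \<le> m"
    then have "m * m \<le> 1048576 * 1048576" using m0 by (intro mult_mono) auto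
    then show False using mn n1 by linarith
  qed
  define bad where "bad d = {a \<in> A. \<not> d dvd a}" for d
  \<comment> \<open>The factor 1024 matches the later bound \<open>q * m <= 1024 * N\<close>, so
    that maximality of \<open>d\<close> covers all divisors of the difference \<open>q\<close>. The
    growth of \<open>64 * d\<close> with \<open>d\<close> leaves many elements of \<open>A'\<close>
    not divisible by \<open>e\<close>.\<close>
  define Ds where "Ds = {d. 1 \<le> d \<and> d * m \<le> 1024 * n' \<and> int (card (bad d)) \<le> 64 * d}"
  have "m \<le> n'" unfolding m_def n'_def using card_mono[OF _ A] by simp
  then have "1 \<in> Ds" using n1 by (simp add: Ds_def bad_def)
  have "Ds \<subseteq> {1..1024 * n'}"
  proof
    fix d assume d: "d \<in> Ds"
    then have "d * 1 \<le> d * m" using m20 by (intro mult_left_mono) (auto simp: Ds_def)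
    then have "d \<le> 1024 * n'" using d unfolding Ds_def mem_Collect_eq mult_1_right by linarith
    then show "d \<in> {1..1024 * n'}" using d by (simp add: Ds_def)
  qed
  then have finD: "finite Ds" using finite_subset by blast
  define d where "d = Max Ds"
  have "d \<in> Ds" unfolding d_def using finD \<open>1 \<in> Ds\<close> by (intro Max_in) auto
  then have d: "1 \<le> d" "d * m \<le> 1024 * n'" "int (card (bad d)) \<le> 64 * d" by (auto simp: Ds_def)
  have dmax: "64 * (d * e) < int (card (bad (d * e)))" if "2 \<le> e" "d * e * m \<le> 1024 * n'" for e
  proof (rule ccontr)
    assume "\<not> ?thesis"
    moreover have "d * 2 \<le> d * e" using d(1) that by (intro mult_left_mono) auto
    moreover from this have "1 \<le> d * e" using d(1) by linarith
    ultimately have "d * e \<in> Ds" using that by (simp add: Ds_def)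
    then have "d * e \<le> d" unfolding d_def using finD by simp
    then show False using \<open>d * 2 \<le> d * e\<close> d(1) by linarith
  qed
  define Ad where "Ad = {a \<in> A. d dvd a}"
  define A' where "A' = div_part d A"
  define M where "M = int (card A')"
  have A'_img: "A' = (\<lambda>x. x div d) ` Ad" unfolding A'_def div_part_def Ad_def by blast
  have inj: "inj_on (\<lambda>x. x div d) Ad" unfolding Ad_def using d(1) by (intro inj_onI) (auto elim!: dvdE)
  have cA': "card A' = card Ad" unfolding A'_img by (rule card_image[OF inj])
  have "card A = card Ad + card (bad d)"
  proof -
    have "A = Ad \<union> bad d" "Ad \<inter> bad d = {}" by (auto simp: Ad_def bad_def)
    then show ?thesis using fin card_Un_disjoint[of Ad "bad d"] by (metis finite_Un)
  qed
  then have mM: "m = M + int (card (bad d))" using cA' by (simp add: m_def M_def)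
  have "128 * d \<le> m"
  proof -
    have "(128 * d) * m \<le> m * m" using d(2) mn n1 unfolding mult.assoc by linarith
    then show ?thesis using m20 by simp
  qed
  then have M2: "m \<le> 2 * M" using mM d(3) by linarith
  define N where "N = n' div d"
  have dN: "d * N \<le> n'"
    using mult_div_mod_eq[of d n'] pos_mod_sign[of d n'] d(1) unfolding N_def by linarith
  have A'N: "A' \<subseteq> {1..N}"
  proof
    fix y assume "y \<in> A'"
    then obtain x where x: "x \<in> A" "d dvd x" "y = x div d" by (auto simp: A'_img Ad_def)
    have xn: "1 \<le> x" "x \<le> n'" using x(1) A by (auto simp: n'_def)
    obtain c where c: "x = d * c" using x(2) by blast
    have "y = c" using c x(3) d(1) by simp
    moreover have "0 < c" using xn c d(1) by (metis less_le_trans zero_less_mult_pos zero_less_one)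
    moreover have "x div d \<le> N" unfolding N_def using xn(2) d(1) by (intro zdiv_mono1) auto
    ultimately show "y \<in> {1..N}" using x(3) by simp
  qed
  have finA': "finite A'" using A'N finite_subset by blast
  have N1: "1 \<le> N"
  proof -
    have "A' \<noteq> {}" using M2 m20 by (auto simp: M_def)
    then show ?thesis using A'N by fastforce
  qed
  \<comment> \<open>\<open>A'\<close> has at least \<open>m / 2\<close> elements in
    \<open>{1..N}\<close> and \<open>d * N <= n'\<close>, so \<open>d * m <= 1024 * n'\<close>
    improves to \<open>2 * n'\<close>; this later bounds the loss \<open>64 * d\<close>.\<close>
  have "M \<le> N" unfolding M_def using card_mono[OF _ A'N] N1 by simp
  then have "d * M \<le> d * N" using d(1) by (intro mult_left_mono) auto
  moreover have "d * m \<le> d * (2 * M)" using M2 d(1) by (intro mult_left_mono) auto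
  ultimately have dm: "d * m \<le> 2 * n'" using dN by linarith
  have "0 < d * m" using d(1) m20 by simp
  \<comment> \<open>\<open>Q\<close> is the largest \<open>e\<close> for which \<open>d * e\<close>
    stays in the range allowed in \<open>Ds\<close>.\<close>
  define Q where "Q = nat (1024 * n' div (d * m))"
  have Qiff: "d * e * m \<le> 1024 * n' \<longleftrightarrow> e \<le> int Q" if "1 \<le> e" for e
  proof -
    have "0 \<le> 1024 * n' div (d * m)" using \<open>0 < d * m\<close> n1 by (simp add: pos_imp_zdiv_nonneg_iff)
    moreover have "e \<le> 1024 * n' div (d * m) \<longleftrightarrow> e * (d * m) \<le> 1024 * n'"
    proof
      assume "e \<le> 1024 * n' div (d * m)"
      then have "e * (d * m) \<le> (1024 * n' div (d * m)) * (d * m)"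
        using \<open>0 < d * m\<close> by (intro mult_right_mono) auto
      then show "e * (d * m) \<le> 1024 * n'"
        using div_mult_mod_eq[of "1024 * n'" "d * m"] pos_mod_sign[OF \<open>0 < d * m\<close>, of "1024 * n'"]
        by linarith
    next
      assume "e * (d * m) \<le> 1024 * n'"
      from zdiv_mono1[OF this \<open>0 < d * m\<close>] show "e \<le> 1024 * n' div (d * m)"
        using d(1) m20 by simp
    qed
    ultimately show ?thesis unfolding Q_def by (simp add: mult_ac)
  qed
  define E where "E e = {a \<in> A'. \<not> int e dvd a}" for e :: nat
  have cE: "E e \<subseteq> A' \<and> 16 * e \<le> card (E e)" if "2 \<le> e" "e \<le> Q" for e
  proof
    show "E e \<subseteq> A'" by (auto simp: E_def)
    \<comment> \<open>An element not divisible by \<open>d * e\<close> is either not divisible by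
      \<open>d\<close> or \<open>d\<close> times an element of \<open>E e\<close>. By maximality of
      \<open>d\<close>, more than \<open>64 * d * e - 64 * d >= 32 * d * e\<close> elements remain
      for \<open>E e\<close>.\<close>
    have "bad (d * int e) \<subseteq> bad d \<union> (\<lambda>a. d * a) ` E e"
    proof
      fix x assume x: "x \<in> bad (d * int e)"
      show "x \<in> bad d \<union> (\<lambda>a. d * a) ` E e"
      proof (cases "d dvd x")
        case True
        then obtain c where c: "x = d * c" by blast
        then have "c = x div d" using d(1) by simp
        then have "c \<in> A'" using x True by (auto simp: A'_img Ad_def bad_def)
        moreover have "\<not> int e dvd c" using x c by (auto simp: bad_def)
        ultimately show ?thesis using c by (auto simp: E_def)
      qed (use x in \<open>auto simp: bad_def\<close>)
    qed
    moreover have finE: "finite (E e)" "finite (bad d)" using finA' fin by (auto simp: E_def bad_def)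
    ultimately have "card (bad (d * int e)) \<le> card (bad d \<union> (\<lambda>a. d * a) ` E e)"
      by (intro card_mono) auto
    also have "\<dots> \<le> card (bad d) + card (E e)"
      using card_Un_le[of "bad d" "(\<lambda>a. d * a) ` E e"] card_image_le[OF finE(1), of "\<lambda>a. d * a"] by linarith
    finally have "64 * (d * int e) < 64 * d + int (card (E e))"
      using dmax[of "int e"] Qiff[of "int e"] that d(3) by simp
    moreover have "d * 2 \<le> d * int e" using d(1) that by (intro mult_left_mono) auto
    moreover have "1 * int e \<le> d * int e" using d(1) by (intro mult_right_mono) auto
    ultimately show "16 * e \<le> card (E e)" by linarith
  qed
  have "16 \<le> card A'" using M2 m20 by (simp add: M_def)
  then obtain R where R: "R \<subseteq> A'" "card A' \<le> 16 * card (A' - R)"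
    "\<And>e. 2 \<le> e \<Longrightarrow> e \<le> Q \<Longrightarrow> e \<le> card (R \<inter> E e)"
    using split_set[OF finA' _ cE] by metis
  define B where "B = A' - R"
  define b where "b = int (card B)"
  have mb: "m \<le> 32 * b" using M2 R(2) by (simp add: M_def b_def B_def)
  have "B \<subseteq> {1..1 + N}" using A'N by (auto simp: B_def)
  moreover have "2048 * N \<le> 2048 * n'"
  proof -
    have "1 * N \<le> d * N" using d(1) N1 by (intro mult_right_mono) auto
    then show ?thesis using dN by linarith
  qed
  moreover have "2^20 * (2048 * n') \<le> b\<^sup>2"
  proof -
    have "m * m \<le> (32 * b) * (32 * b)" using mb m0 by (intro mult_mono) auto
    then show ?thesis using mn n1 by (simp add: power2_eq_square)
  qed
  ultimately obtain q k a where q: "0 < q" "q * b \<le> 32 * N" "int k * b \<le> 2^18 * (2048 * n')"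
    "ap a q (2048 * n') \<subseteq> ssum k B"
    using long_ap[OF N1, of B 1 "2048 * n'"] unfolding b_def by blast
  have "q * m \<le> q * (32 * b)" using mb q(1) by (intro mult_left_mono) auto
  then have qm: "q * m \<le> 1024 * N" using q(2) by linarith
  have "int k * m \<le> int k * (32 * b)" using mb by (intro mult_left_mono) auto
  then have km: "int k * m \<le> 17179869184 * n'" using q(3) by simp
  \<comment> \<open>Multiplying by \<open>d\<close> and using \<open>d * N <= n'\<close> gives
    \<open>q <= Q\<close>, so the non-divisibility secured for \<open>R\<close> covers every divisor
    of \<open>q\<close> above 1.\<close>
  have "d * (q * m) \<le> d * (1024 * N)" using qm d(1) by (intro mult_left_mono) auto
  then have "d * q * m \<le> 1024 * n'" using dN by (simp add: mult.assoc)
  then have qQ: "q \<le> int Q" using Qiff[of q] q(1) by simp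
  have fill: "e \<le> int (card {x \<in> R. \<not> e dvd x})" if "e dvd q" "1 < e" for e
  proof -
    have "e \<le> q" using that q(1) by (simp add: zdvd_imp_le)
    then have "nat e \<le> card (R \<inter> E (nat e))" using R(3)[of "nat e"] that qQ by simp
    moreover have "R \<inter> E (nat e) = {x \<in> R. \<not> e dvd x}" using R(1) that by (auto simp: E_def)
    ultimately show ?thesis using that by simp
  qed
  have Nn: "N \<le> n'" using \<open>2048 * N \<le> 2048 * n'\<close> by simp
  have rm: "0 < real (card A)" using m20 by (simp add: m_def)
  have "real k + real_of_int q \<le> 2^50 * real n / real (card A)"
  proof -
    have "(int k + q) * m \<le> 1125899906842624 * n'"
      using km qm Nn n1 by (simp add: distrib_right)
    then have "real_of_int ((int k + q) * m) \<le> real_of_int (1125899906842624 * n')" by linarith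
    then have "(real k + real_of_int q) * real (card A) \<le> 2^50 * real n"
      by (simp add: m_def n'_def)
    then show ?thesis using rm by (simp add: pos_le_divide_eq)
  qed
  moreover have "q * N + n' \<le> q * (2048 * n')"
  proof -
    have "q * N \<le> q * n'" using Nn q(1) by (intro mult_left_mono) auto
    moreover have "1 * n' \<le> q * n'" using q(1) n1 by (intro mult_right_mono) auto
    moreover have "q * (2048 * n') = 2048 * (q * n')" by simp
    moreover have "0 \<le> q * n'" using q(1) n1 by simp
    ultimately show ?thesis by linarith
  qed
  ultimately have "\<exists>c. {c..<c + int n} \<subseteq> subset_sums_le (2^50 * real n / real (card A)) A'"
    using interval_in_subset_sums[of R B A' N q a "2048 * n'" k n', OF _ _ A'N _ q(1,4) _ fill] R(1) N1
    unfolding n'_def B_def by (simp add: Un_absorb1)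
  moreover have "real (card A) - real (card A') \<le> 2^30 * real n / real (card A)"
  proof -
    have "(m - M) * m \<le> (64 * d) * m" using mM d(3) m0 by (intro mult_right_mono) auto
    then have "(m - M) * m \<le> 1073741824 * n'" using dm n1 unfolding mult.assoc by linarith
    then have "real_of_int ((m - M) * m) \<le> real_of_int (1073741824 * n')" by linarith
    then have "(real (card A) - real (card A')) * real (card A) \<le> 2^30 * real n"
      by (simp add: m_def M_def n'_def)
    then show ?thesis using rm by (simp add: pos_le_divide_eq)
  qed
  ultimately show ?thesis using d(1) unfolding A'_def by blast
qed

theorem theorem6p1:
  shows "\<exists>C::real. C > 0 \<and>
    (\<forall>(n::nat) (A::int set).
       A \<subseteq> {1..int n} \<and> real (card A) \<ge> C * sqrt (real n) \<longrightarrow>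
       (\<exists>d::int. d \<ge> 1 \<and>
          (\<exists>a::int. {a..<a + int n} \<subseteq>
              subset_sums_le (2^50 * real n / real (card A)) (div_part d A)) \<and>
          real (card A) - real (card (div_part d A))
            \<le> 2^30 * (ln (real n))^3 + 2^30 * real n / real (card A)))"
proof (intro exI[of _ "2^30 :: real"] conjI allI impI)
  fix n :: nat and A :: "int set"
  assume asm: "A \<subseteq> {1..int n} \<and> real (card A) \<ge> 2^30 * sqrt (real n)"
  show "\<exists>d::int. d \<ge> 1 \<and>
          (\<exists>a::int. {a..<a + int n} \<subseteq>
              subset_sums_le (2^50 * real n / real (card A)) (div_part d A)) \<and>
          real (card A) - real (card (div_part d A))
            \<le> 2^30 * (ln (real n))^3 + 2^30 * real n / real (card A)"
  proof (cases "n = 0")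
    case True
    then have "A = {}" using asm by simp
    \<comment> \<open>The interval is empty and the inequality reads \<open>0 <= 0\<close>, by the
      conventions \<open>ln 0 = 0\<close> and \<open>0 / 0 = 0\<close>.\<close>
    then show ?thesis using True by (intro exI[of _ 1]) (simp add: div_part_def)
  next
    case False
    \<comment> \<open>Squaring turns the constant \<open>2^30\<close> into the factor
      \<open>2^60\<close> of \<open>subset_sums_main\<close>.\<close>
    have "(2^30 * sqrt (real n))\<^sup>2 \<le> (real (card A))\<^sup>2" using asm by (intro power_mono) auto
    then have "real (2^60 * n) \<le> real ((card A)\<^sup>2)" by (simp add: power_mult_distrib)
    then have "2^60 * n \<le> (card A)\<^sup>2" by linarith
    then obtain d a where "d \<ge> 1"
      "{a..<a + int n} \<subseteq> subset_sums_le (2^50 * real n / real (card A)) (div_part d A)"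
      "real (card A) - real (card (div_part d A)) \<le> 2^30 * real n / real (card A)"
      using subset_sums_main[of A n] asm False by auto
    moreover have "0 \<le> 2^30 * (ln (real n))^3" using False by simp
    ultimately show ?thesis by (intro exI[of _ d] conjI exI[of _ a]) linarith+
  qed
qed simp

end
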